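(* Let $G$ be a Helly $EPT$ graph and let $h\geq 3$ be an integer. Then $G\notin$ Helly $[h,2,2]$ if and only if there exists an integer $k>h$ such that $G$ has a $k$-gate as an induced subgraph.
   Context: All graphs are finite and simple. An $EPT$ representation of a graph $G$ is a pair $\langle \mathcal{P},T\rangle$ where $T$ is a tree (the host tree) and $\mathcal{P}=(P_v)_{v\in V(G)}$ is a family of subpaths of $T$ such that two distinct vertices $v,w$ of $G$ are adjacent if and only if $E(P_v)\cap E(P_w)\neq\emptyset$. $G$ is $EPT$ if it has such a representation. If the host tree has maximum degree $h$, the representation is an $(h,2,2)$-representation; $[h,2,2]$ is the class of graphs admitting an $(h,2,2)$-representation. A representation is Helly if the family $(E(P))_{P\in\mathcal{P}}$ has the Helly property (every pairwise intersecting subfamily has nonempty total intersection). $G$ is Helly $EPT$ if it has a Helly $EPT$ representation, and $G\in$ Helly $[h,2,2]$ if it has a Helly $(h,2,2)$-representation. A clique is a maximal complete set of vertices. Gates are defined recursively: (i) every chordless cycle $C_n$ with $n\geq 4$ is a gate; (ii) if $H$ is a gate, $C$ and $C'$ are disjoint cliques of $H$, and $P=(v_1,\dots,v_l)$ with $l\geq 2$ is a chordless path vertex-disjoint from $H$, then the graph consisting of the union of $H$ and $P$ together with all edges between $v_1$ and the vertices of $C$ and all edges between $v_l$ and the vertices of $C'$ is a gate; (iii) there are no other gates. A gate with exactly $k$ cliques is called a $k$-gate. *)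

theory Defs
  imports Main
begin

definition graph :: "'a set \<Rightarrow> 'a set set \<Rightarrow> bool" where
  "graph V E \<longleftrightarrow> finite V \<and> (\<forall>e\<in>E. e \<subseteq> V \<and> card e = 2)"

definition induced_edges :: "'a set set \<Rightarrow> 'a set \<Rightarrow> 'a set set" where
  "induced_edges E S = {e \<in> E. e \<subseteq> S}"

definition complete_set :: "'a set set \<Rightarrow> 'a set \<Rightarrow> bool" where
  "complete_set E C \<longleftrightarrow> (\<forall>u\<in>C. \<forall>w\<in>C. u \<noteq> w \<longrightarrow> {u, w} \<in> E)"

definition is_clique :: "'a set \<Rightarrow> 'a set set \<Rightarrow> 'a set \<Rightarrow> bool" where
  "is_clique V E C \<longleftrightarrow> C \<subseteq> V \<and> complete_set E C \<and>
     (\<forall>D. C \<subset> D \<and> D \<subseteq> V \<longrightarrow> \<not> complete_set E D)"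

definition cliques :: "'a set \<Rightarrow> 'a set set \<Rightarrow> 'a set set" where
  "cliques V E = {C. is_clique V E C}"

definition path_edges :: "'a list \<Rightarrow> 'a set set" where
  "path_edges ps = {{ps ! i, ps ! Suc i} | i. Suc i < length ps}"

definition is_path :: "'a set \<Rightarrow> 'a set set \<Rightarrow> 'a list \<Rightarrow> bool" where
  "is_path V E ps \<longleftrightarrow> ps \<noteq> [] \<and> distinct ps \<and> set ps \<subseteq> V \<and> path_edges ps \<subseteq> E"

definition cycle_edges :: "'a list \<Rightarrow> 'a set set" where
  "cycle_edges cs = {{cs ! i, cs ! ((Suc i) mod length cs)} | i. i < length cs}"

definition connected_graph :: "'a set \<Rightarrow> 'a set set \<Rightarrow> bool" where
  "connected_graph V E \<longleftrightarrow>
     (\<forall>u\<in>V. \<forall>w\<in>V. \<exists>ps. is_path V E ps \<and> hd ps = u \<and> last ps = w)"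

definition acyclic_graph :: "'a set \<Rightarrow> 'a set set \<Rightarrow> bool" where
  "acyclic_graph V E \<longleftrightarrow>
     \<not> (\<exists>cs. length cs \<ge> 3 \<and> distinct cs \<and> set cs \<subseteq> V \<and> cycle_edges cs \<subseteq> E)"

definition is_tree :: "'b set \<Rightarrow> 'b set set \<Rightarrow> bool" where
  "is_tree V E \<longleftrightarrow> graph V E \<and> V \<noteq> {} \<and> connected_graph V E \<and> acyclic_graph V E"

definition degree :: "'b set set \<Rightarrow> 'b \<Rightarrow> nat" where
  "degree E x = card {e \<in> E. x \<in> e}"

definition max_degree :: "'b set \<Rightarrow> 'b set set \<Rightarrow> nat" where
  "max_degree V E = Max (degree E ` V)"

definition tree_subpath :: "'b set \<Rightarrow> 'b set set \<Rightarrow> 'b list \<Rightarrow> bool" where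
  "tree_subpath VT ET ps \<longleftrightarrow> is_path VT ET ps \<and> length ps \<ge> 2"

definition ept_rep :: "'a set \<Rightarrow> 'a set set \<Rightarrow> 'b set \<Rightarrow> 'b set set \<Rightarrow> ('a \<Rightarrow> 'b list) \<Rightarrow> bool" where
  "ept_rep V E VT ET P \<longleftrightarrow> is_tree VT ET \<and> (\<forall>v\<in>V. tree_subpath VT ET (P v)) \<and>
     (\<forall>v\<in>V. \<forall>w\<in>V. v \<noteq> w \<longrightarrow> ({v, w} \<in> E \<longleftrightarrow> path_edges (P v) \<inter> path_edges (P w) \<noteq> {}))"

definition helly_family :: "'a set \<Rightarrow> ('a \<Rightarrow> 'c set) \<Rightarrow> bool" where
  "helly_family I F \<longleftrightarrow> (\<forall>S\<subseteq>I. S \<noteq> {} \<and> (\<forall>v\<in>S. \<forall>w\<in>S. F v \<inter> F w \<noteq> {}) \<longrightarrow>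
     (\<Inter>v\<in>S. F v) \<noteq> {})"

definition helly_ept_rep :: "'a set \<Rightarrow> 'a set set \<Rightarrow> 'b set \<Rightarrow> 'b set set \<Rightarrow> ('a \<Rightarrow> 'b list) \<Rightarrow> bool" where
  "helly_ept_rep V E VT ET P \<longleftrightarrow> ept_rep V E VT ET P \<and> helly_family V (\<lambda>v. path_edges (P v))"

text \<open>Host trees are finite, so their vertices can be taken to be natural numbers.\<close>
definition helly_ept :: "'a set \<Rightarrow> 'a set set \<Rightarrow> bool" where
  "helly_ept V E \<longleftrightarrow> (\<exists>(VT :: nat set) ET P. helly_ept_rep V E VT ET P)"

definition helly_h22 :: "'a set \<Rightarrow> 'a set set \<Rightarrow> nat \<Rightarrow> bool" where
  "helly_h22 V E h \<longleftrightarrow> (\<exists>(VT :: nat set) ET P. helly_ept_rep V E VT ET P \<and> max_degree VT ET = h)"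

inductive gate :: "'a set \<Rightarrow> 'a set set \<Rightarrow> bool" where
  cycle: "\<lbrakk> distinct cs; length cs \<ge> 4 \<rbrakk> \<Longrightarrow> gate (set cs) (cycle_edges cs)"
| extend: "\<lbrakk> gate V E; is_clique V E C; is_clique V E C'; C \<inter> C' = {};
             distinct ps; length ps \<ge> 2; set ps \<inter> V = {} \<rbrakk> \<Longrightarrow>
           gate (V \<union> set ps)
                (E \<union> path_edges ps \<union> {{hd ps, c} | c. c \<in> C} \<union> {{last ps, c} | c. c \<in> C'})"

definition k_gate :: "'a set \<Rightarrow> 'a set set \<Rightarrow> nat \<Rightarrow> bool" where
  "k_gate V E k \<longleftrightarrow> gate V E \<and> card (cliques V E) = k"

text \<open>G has a k-gate as induced subgraph: some induced subgraph of G is a k-gate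
  (the gate predicate is closed under renaming vertices within the type).\<close>
definition has_induced_k_gate :: "'a set \<Rightarrow> 'a set set \<Rightarrow> nat \<Rightarrow> bool" where
  "has_induced_k_gate V E k \<longleftrightarrow> (\<exists>S\<subseteq>V. k_gate S (induced_edges E S) k)"

end

theory Submission
  imports Defs
begin

text \<open>
  Trees are handled through cuts: every proper vertex set is crossed by an edge, and every edge is
  the only one crossing some vertex set.

  A gate has no clique separator. In a Helly representation of a graph without clique separator,
  every tree edge has all paths avoiding it on one side; orienting the tree edges accordingly, a
  sink is a vertex \<open>q\<close> on all paths, and by the Helly property distinct cliques occupy distinct
  edges at \<open>q\<close>. Hence \<open>q\<close> has degree at least the number of cliques.

  Conversely, take a Helly representation minimising the sum of \<open>degree x - 3\<close> (truncated at 0) and a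
  vertex \<open>q\<close> of degree greater than \<open>h\<close>. Join two neighbours of \<open>q\<close> if some path runs through both.
  By the Helly property this local graph is triangle-free. If it is 2-connected, a minimal
  2-connected spanning subgraph has an ear decomposition in which no ear joins adjacent vertices;
  its line graph is an induced gate with \<open>degree q\<close> cliques. Otherwise a cut vertex \<open>a\<close> separates the
  other neighbours into \<open>A\<close> and \<open>B\<close>, and \<open>q\<close> can be split into two vertices of smaller degree,
  contradicting minimality. The new vertex on the edge towards \<open>a\<close> has degree 3, whence \<open>h \<ge> 3\<close>.
\<close>

text \<open>Each edge of the local graph at \<open>q\<close> is realised by a vertex of
  \<open>G\<close> whose path uses both corresponding edges at \<open>q\<close>. Two such paths
  share an edge exactly when the local edges share an end, so the chosen vertices induce the line
  graph of the local graph. For a triangle-free graph of minimum degree at least 2, the cliques of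
  the line graph are the stars, one for each vertex; this is where the clique count
  \<open>degree q\<close> comes from. Ear ends have to be nonadjacent because the recursive clause
  for gates asks for disjoint cliques, and the stars of \<open>c\<close> and \<open>d\<close> can
  meet only in the edge \<open>{c, d}\<close>. Splitting has an obstacle: paths leading from
  \<open>a\<close> into \<open>A\<close> and into \<open>B\<close> must go on sharing an edge.
  Subdividing the edge towards \<open>a\<close> keeps such an edge, and it costs the vertex of
  degree 3 that explains the truncation. Cuts suit this construction since they can be pulled back
  along the contraction that undoes the split. Maximum degree exactly \<open>h\<close>, not merely
  at most \<open>h\<close>, is finally reached by hanging leaves on the host tree.\<close>

definition crosses :: "'a set \<Rightarrow> 'a set \<Rightarrow> bool" where
  "crosses e S \<longleftrightarrow> e \<inter> S \<noteq> {} \<and> e - S \<noteq> {}"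

lemma crosses_pair: "crosses {x, y} S \<longleftrightarrow> (x \<in> S) \<noteq> (y \<in> S)"
  by (auto simp: crosses_def)

lemma crosses_Compl [simp]: "crosses e (- S) \<longleftrightarrow> crosses e S"
  by (auto simp: crosses_def)

lemma graph_edgeE:
  assumes "graph V E" "e \<in> E"
  obtains x y where "e = {x, y}" "x \<noteq> y" "x \<in> V" "y \<in> V"
  using assms by (fastforce simp: graph_def card_2_iff)

lemma graph_edgeD:
  assumes "graph V E" "{x, y} \<in> E"
  shows "x \<noteq> y" "x \<in> V" "y \<in> V"
  using assms by (force simp: graph_def card_2_iff)+

lemma graph_finite_edges: "graph V E \<Longrightarrow> finite E"
  unfolding graph_def by (meson finite_Pow_iff finite_subset PowI subsetI)

subsection \<open>Lists of consecutive vertices\<close>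

lemma path_edgesE:
  assumes "e \<in> path_edges ps"
  obtains k where "Suc k < length ps" "e = {ps ! k, ps ! Suc k}"
  using assms unfolding path_edges_def by blast

lemma path_edges_Nil [simp]: "path_edges [] = {}"
  by (simp add: path_edges_def)

lemma path_edges_single [simp]: "path_edges [x] = {}"
  by (simp add: path_edges_def)

lemma path_edges_Cons2 [simp]: "path_edges (x # y # zs) = insert {x, y} (path_edges (y # zs))"
proof (rule set_eqI)
  fix e
  show "e \<in> path_edges (x # y # zs) \<longleftrightarrow> e \<in> insert {x, y} (path_edges (y # zs))"
    (is "?L \<longleftrightarrow> ?R")
  proof
    assume ?L
    then obtain i where i: "e = {(x # y # zs) ! i, (x # y # zs) ! Suc i}" "Suc i < length (x # y # zs)"
      unfolding path_edges_def by blast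
    then show ?R
      by (cases i) (auto simp: path_edges_def)
  next
    assume ?R
    then show ?L
    proof
      assume "e = {x, y}"
      then show ?L unfolding path_edges_def by force
    next
      assume "e \<in> path_edges (y # zs)"
      then obtain i where "e = {(y # zs) ! i, (y # zs) ! Suc i}" "Suc i < length (y # zs)"
        unfolding path_edges_def by blast
      then show ?L
        unfolding path_edges_def by (intro CollectI exI[of _ "Suc i"]) auto
    qed
  qed
qed

lemma path_edges_Cons:
  "path_edges (x # xs) = (if xs = [] then {} else insert {x, hd xs} (path_edges xs))"
  by (cases xs) auto

lemma path_edges_append:
  "path_edges (xs @ ys) = path_edges xs \<union> path_edges ys \<union>
     (if xs = [] \<or> ys = [] then {} else {{last xs, hd ys}})"
  by (induction xs) (auto simp: path_edges_Cons)

lemma path_edges_map: "path_edges (map f xs) = (`) f ` path_edges xs"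
  by (induction xs) (auto simp: path_edges_Cons hd_map)

lemma path_edges_subset: "e \<in> path_edges xs \<Longrightarrow> e \<subseteq> set xs"
  by (auto simp: path_edges_def)

lemma path_edges_nonempty: "length xs \<ge> 2 \<Longrightarrow> path_edges xs \<noteq> {}"
  by (cases xs; cases "tl xs") auto

text \<open>Removes the modular indices: index 0 gives the edge into \<open>ys\<close>, the last
  index wraps around to \<open>x\<close>, and the indices in between are the consecutive pairs of
  \<open>ys\<close>.\<close>

lemma cycle_edges_Cons:
  assumes "ys \<noteq> []"
  shows "cycle_edges (x # ys) = insert {x, hd ys} (insert {last ys, x} (path_edges ys))"
proof (rule set_eqI)
  fix e
  let ?n = "length ys"
  have *: "(\<exists>i < Suc ?n. Q i) \<longleftrightarrow> Q 0 \<or> (\<exists>i < ?n. Q (Suc i))" for Q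
    by (metis Suc_less_eq not0_implies_Suc zero_less_Suc)
  have **: "(\<exists>i < ?n. Q i) \<longleftrightarrow> Q (?n - 1) \<or> (\<exists>i. Suc i < ?n \<and> Q i)" for Q
    using assms by (metis Suc_lessD Suc_lessI diff_Suc_1 length_greater_0_conv diff_less zero_less_one)
  have "e \<in> cycle_edges (x # ys) \<longleftrightarrow>
      (\<exists>i < Suc ?n. e = {(x # ys) ! i, (x # ys) ! (Suc i mod Suc ?n)})"
    by (auto simp: cycle_edges_def)
  also have "\<dots> \<longleftrightarrow> e = {x, hd ys} \<or>
      (\<exists>i < ?n. e = {ys ! i, (x # ys) ! (Suc (Suc i) mod Suc ?n)})"
    using assms unfolding * by (cases ys) auto
  also have "\<dots> \<longleftrightarrow> e = {x, hd ys} \<or> e = {last ys, x} \<or>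
      (\<exists>i. Suc i < ?n \<and> e = {ys ! i, ys ! Suc i})"
    using assms unfolding ** by (auto simp: last_conv_nth)
  also have "\<dots> \<longleftrightarrow> e \<in> insert {x, hd ys} (insert {last ys, x} (path_edges ys))"
    by (auto simp: path_edges_def)
  finally show "e \<in> cycle_edges (x # ys) \<longleftrightarrow>
    e \<in> insert {x, hd ys} (insert {last ys, x} (path_edges ys))" .
qed

text \<open>A discrete intermediate value principle: membership in \<open>S\<close> must change
  between two consecutive entries. Paths enter the cut arguments through it.\<close>

lemma path_crosses:
  assumes "set ps \<inter> S \<noteq> {}" "\<not> set ps \<subseteq> S"
  shows "\<exists>e \<in> path_edges ps. crosses e S"
  using assms
proof (induction ps)
  case (Cons x xs)
  show ?case
  proof (cases xs)
    case Nil
    with Cons.prems show ?thesis by auto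
  next
    case (Cons y zs)
    with Cons.IH Cons.prems show ?thesis
      by (cases "x \<in> S"; cases "y \<in> S") (auto simp: crosses_pair)
  qed
qed auto

lemma path_edges_at:
  assumes "distinct (l1 @ q # l2)"
  shows "{q, x} \<in> path_edges (l1 @ q # l2) \<longleftrightarrow>
    l1 \<noteq> [] \<and> x = last l1 \<or> l2 \<noteq> [] \<and> x = hd l2"
proof -
  have "{q, x} \<notin> path_edges l1" "{q, x} \<notin> path_edges l2"
    using assms path_edges_subset[of "{q, x}" l1] path_edges_subset[of "{q, x}" l2] by auto
  then show ?thesis
    using assms by (auto simp: path_edges_append path_edges_Cons doubleton_eq_iff)
qed

lemma path_edge_in_set:
  assumes "{q, x} \<in> path_edges ps" shows "q \<in> set ps"
  using path_edges_subset[OF assms] by auto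

text \<open>A duplicate-free list visits \<open>q\<close> once, so only its predecessor and its
  successor can be joined to it.\<close>

lemma path_at_most_two:
  assumes "distinct ps" "{q, x} \<in> path_edges ps" "{q, y} \<in> path_edges ps"
    "{q, w} \<in> path_edges ps" "x \<noteq> y"
  shows "w = x \<or> w = y"
proof -
  obtain l1 l2 where "ps = l1 @ q # l2"
    using path_edge_in_set[OF assms(2)] by (meson split_list)
  then show ?thesis using assms path_edges_at by metis
qed

lemma path_edge_neq:
  assumes "distinct ps" "{x, y} \<in> path_edges ps" shows "x \<noteq> y"
proof
  assume "x = y"
  obtain l1 l2 where ps: "ps = l1 @ x # l2"
    using path_edge_in_set[OF assms(2)] by (meson split_list)
  have "l1 \<noteq> [] \<and> x = last l1 \<or> l2 \<noteq> [] \<and> x = hd l2"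
    using assms path_edges_at ps \<open>x = y\<close> by metis
  then show False using assms(1) ps by auto
qed

text \<open>Appending \<open>s\<close> would repeat it if the path already visits it; in that case
  the prefix ending in \<open>s\<close> serves.\<close>

lemma is_path_extend:
  assumes "is_path V E ps" "{last ps, s} \<in> E" "s \<in> V"
  shows "\<exists>ps'. is_path V E ps' \<and> hd ps' = hd ps \<and> last ps' = s"
proof (cases "s \<in> set ps")
  case True
  then obtain l1 l2 where ps: "ps = l1 @ s # l2" by (meson split_list)
  have "path_edges ((l1 @ [s]) @ l2) = path_edges ps" using ps by simp
  then have "path_edges (l1 @ [s]) \<subseteq> path_edges ps"
    unfolding path_edges_append[of "l1 @ [s]" l2] by blast
  then have "is_path V E (l1 @ [s])"
    using assms(1) ps unfolding is_path_def by auto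
  moreover have "hd (l1 @ [s]) = hd ps" using ps by (cases l1) auto
  ultimately show ?thesis by force
next
  case False
  then have "is_path V E (ps @ [s])"
    using assms unfolding is_path_def by (auto simp: path_edges_append)
  moreover have "hd (ps @ [s]) = hd ps" using assms(1) by (simp add: is_path_def)
  ultimately show ?thesis by force
qed

section \<open>Reachability by simple paths\<close>

definition reach :: "'a set \<Rightarrow> 'a set set \<Rightarrow> 'a \<Rightarrow> 'a set" where
  "reach V E u = {w. \<exists>ps. is_path V E ps \<and> hd ps = u \<and> last ps = w}"

lemma reach_self: "u \<in> V \<Longrightarrow> u \<in> reach V E u"
  unfolding reach_def by (auto intro!: exI[of _ "[u]"] simp: is_path_def)

lemma reach_step: "w \<in> reach V E u \<Longrightarrow> {w, s} \<in> E \<Longrightarrow> s \<in> V \<Longrightarrow> s \<in> reach V E u"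
  unfolding reach_def using is_path_extend by fastforce

lemma reach_subset: "reach V E u \<subseteq> V"
  unfolding reach_def is_path_def using last_in_set by blast

subsection \<open>Trees by cuts\<close>

definition cut_connected :: "'a set \<Rightarrow> 'a set set \<Rightarrow> bool" where
  "cut_connected V E \<longleftrightarrow> (\<forall>S. V \<inter> S \<noteq> {} \<and> \<not> V \<subseteq> S \<longrightarrow> (\<exists>e\<in>E. crosses e S))"

text \<open>Acyclicity with a witness for every edge. Such a cut can be transported along a map of
  vertices, which is harder to do with the absence of cycles.\<close>

definition all_bridges :: "'a set set \<Rightarrow> bool" where
  "all_bridges E \<longleftrightarrow> (\<forall>e\<in>E. \<exists>S. crosses e S \<and> (\<forall>f\<in>E. crosses f S \<longrightarrow> f = e))"

text \<open>For the converse, no edge leaves the set reachable from \<open>u\<close>, so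
  connectivity by cuts forces this set to contain all of \<open>V\<close>.\<close>

lemma connected_graph_iff_cut:
  assumes "graph V E"
  shows "connected_graph V E \<longleftrightarrow> cut_connected V E"
proof
  assume c: "connected_graph V E"
  show "cut_connected V E"
    unfolding cut_connected_def
  proof (intro allI impI)
    fix S assume "V \<inter> S \<noteq> {} \<and> \<not> V \<subseteq> S"
    then obtain u w where uw: "u \<in> V" "u \<in> S" "w \<in> V" "w \<notin> S" by auto
    with c obtain ps where ps: "is_path V E ps" "hd ps = u" "last ps = w"
      unfolding connected_graph_def by blast
    then have "u \<in> set ps" "w \<in> set ps" by (auto simp: is_path_def)
    with uw have "\<exists>e \<in> path_edges ps. crosses e S"
      by (intro path_crosses) auto
    then show "\<exists>e\<in>E. crosses e S" using ps by (auto simp: is_path_def)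
  qed
next
  assume c: "cut_connected V E"
  have "w \<in> reach V E u" if uw: "u \<in> V" "w \<in> V" for u w
  proof (rule ccontr)
    assume "w \<notin> reach V E u"
    then have "V \<inter> reach V E u \<noteq> {} \<and> \<not> V \<subseteq> reach V E u"
      using uw reach_self by fast
    then obtain e where e: "e \<in> E" "crosses e (reach V E u)"
      using c unfolding cut_connected_def by blast
    then obtain x y where "e = {x, y}" "x \<in> V" "y \<in> V"
      using graph_edgeE[OF assms] by metis
    with e show False
      using reach_step[of x V E u y] reach_step[of y V E u x]
      by (auto simp: crosses_pair insert_commute)
  qed
  then show "connected_graph V E"
    unfolding connected_graph_def reach_def by blast
qed

text \<open>On a cycle, the edge \<open>{x, y}\<close> is bypassed by the remaining path from
  \<open>y\<close> to \<open>x\<close>. The bypass must cross the same cut and hence contain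
  \<open>{x, y}\<close> itself, although it leaves \<open>y\<close> towards a different
  vertex.\<close>

lemma all_bridges_acyclic:
  assumes "all_bridges E"
  shows "acyclic_graph V E"
  unfolding acyclic_graph_def
proof
  assume "\<exists>cs. length cs \<ge> 3 \<and> distinct cs \<and> set cs \<subseteq> V \<and> cycle_edges cs \<subseteq> E"
  then obtain cs where cs: "length cs \<ge> 3" "distinct cs" "cycle_edges cs \<subseteq> E" by blast
  then obtain x y zs where csx: "cs = x # y # zs" and zs: "zs \<noteq> []"
    by (metis One_nat_def Suc_1 Suc_le_length_iff list.distinct(1) numeral_3_eq_3)
  let ?ps = "y # zs @ [x]"
  have ce: "cycle_edges cs = insert {x, y} (path_edges ?ps)"
    using csx zs by (auto simp: cycle_edges_Cons path_edges_Cons path_edges_append insert_commute)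
  then have "{x, y} \<in> E" using cs(3) by blast
  then obtain S where S: "crosses {x, y} S" "\<And>f. f \<in> E \<Longrightarrow> crosses f S \<Longrightarrow> f = {x, y}"
    using assms unfolding all_bridges_def by meson
  have "\<exists>e \<in> path_edges ?ps. crosses e S"
    using S(1) by (intro path_crosses) (auto simp: crosses_pair)
  then have "{y, x} \<in> path_edges ?ps"
    using S(2) ce cs(3) by (auto simp: insert_commute)
  moreover have "{y, x} \<in> path_edges ([] @ y # zs @ [x]) \<longleftrightarrow> x = hd zs"
    using path_edges_at[of "[]" y "zs @ [x]" x] cs(2) csx zs by auto
  ultimately have "x = hd zs" by simp
  then show False using cs(2) csx zs by simp
qed

text \<open>The cut for \<open>{x, y}\<close> is the set reachable from \<open>y\<close> once the
  edge is deleted; if it contained \<open>x\<close>, the edge would close a cycle.\<close>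

lemma acyclic_all_bridges:
  assumes "graph V E" "acyclic_graph V E"
  shows "all_bridges E"
  unfolding all_bridges_def
proof
  fix e assume e: "e \<in> E"
  obtain x y where xy: "e = {x, y}" "x \<noteq> y" "x \<in> V" "y \<in> V"
    using graph_edgeE[OF assms(1) e] .
  let ?S = "reach V (E - {e}) y"
  have "x \<notin> ?S"
  proof
    assume "x \<in> ?S"
    then obtain ps where ps: "is_path V (E - {e}) ps" "hd ps = y" "last ps = x"
      unfolding reach_def by blast
    obtain zs where zs: "ps = y # zs" "zs \<noteq> []"
      using ps xy(2) by (cases ps) (auto simp: is_path_def split: if_splits)
    have "tl zs \<noteq> []"
    proof
      assume "tl zs = []"
      then have "ps = [y, x]" using zs ps by (cases zs) auto
      then show False using ps(1) xy(1) by (auto simp: is_path_def insert_commute)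
    qed
    then have "length ps \<ge> 3" using zs by (cases zs; cases "tl zs") auto
    moreover have "cycle_edges ps \<subseteq> E"
      using ps zs e xy(1) by (auto simp: cycle_edges_Cons path_edges_Cons is_path_def)
    ultimately show False
      using assms(2) ps(1) unfolding acyclic_graph_def is_path_def by blast
  qed
  moreover have "y \<in> ?S" using reach_self[OF xy(4)] .
  moreover have "f = e" if f: "f \<in> E" "crosses f ?S" for f
  proof (rule ccontr)
    assume "f \<noteq> e"
    obtain u w where "f = {u, w}" "u \<in> V" "w \<in> V"
      using graph_edgeE[OF assms(1) f(1)] by metis
    with f \<open>f \<noteq> e\<close> show False
      using reach_step[of u V "E - {e}" y w] reach_step[of w V "E - {e}" y u]
      by (auto simp: crosses_pair insert_commute)
  qed
  ultimately show "\<exists>S. crosses e S \<and> (\<forall>f\<in>E. crosses f S \<longrightarrow> f = e)"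
    using xy(1) by (intro exI[of _ ?S]) (auto simp: crosses_pair)
qed

lemma is_tree_iff_cut:
  "is_tree V E \<longleftrightarrow> graph V E \<and> V \<noteq> {} \<and> cut_connected V E \<and> all_bridges E"
  unfolding is_tree_def
  using connected_graph_iff_cut all_bridges_acyclic acyclic_all_bridges by blast

text \<open>For a tree edge this is the component of \<open>y\<close> after deleting
  \<open>{x, y}\<close>, as far as the tree is concerned. Membership outside the tree is
  unspecified, which explains the intersections with \<open>VT\<close> below.\<close>

definition side :: "'b set set \<Rightarrow> 'b \<Rightarrow> 'b \<Rightarrow> 'b set" where
  "side E x y = (SOME S. y \<in> S \<and> x \<notin> S \<and> (\<forall>f\<in>E. crosses f S \<longrightarrow> f = {x, y}))"

locale tree =
  fixes VT :: "'b set" and ET :: "'b set set"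
  assumes tree: "is_tree VT ET"
begin

lemma graph: "graph VT ET" and nonempty: "VT \<noteq> {}"
  using tree by (auto simp: is_tree_def)

lemma finite_VT: "finite VT"
  using graph by (simp add: graph_def)

lemma cut: "VT \<inter> S \<noteq> {} \<Longrightarrow> \<not> VT \<subseteq> S \<Longrightarrow> \<exists>e\<in>ET. crosses e S"
  using tree unfolding is_tree_iff_cut cut_connected_def by blast

lemma side:
  assumes "{x, y} \<in> ET"
  shows "y \<in> side ET x y" "x \<notin> side ET x y"
    "\<And>f. f \<in> ET \<Longrightarrow> crosses f (side ET x y) \<Longrightarrow> f = {x, y}"
proof -
  obtain S where S: "crosses {x, y} S" "\<forall>f\<in>ET. crosses f S \<longrightarrow> f = {x, y}"
    using tree assms unfolding is_tree_iff_cut all_bridges_def by blast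
  have "\<exists>S. y \<in> S \<and> x \<notin> S \<and> (\<forall>f\<in>ET. crosses f S \<longrightarrow> f = {x, y})"
  proof (cases "y \<in> S")
    case True
    then show ?thesis using S by (auto simp: crosses_pair)
  next
    case False
    then show ?thesis using S by (intro exI[of _ "- S"]) (auto simp: crosses_pair)
  qed
  from someI_ex[OF this]
  show "y \<in> side ET x y" "x \<notin> side ET x y"
    "\<And>f. f \<in> ET \<Longrightarrow> crosses f (side ET x y) \<Longrightarrow> f = {x, y}"
    unfolding side_def[symmetric] by blast+
qed

lemma side_edge:
  assumes "{x, y} \<in> ET" "{u, w} \<in> ET" "{u, w} \<noteq> {x, y}"
  shows "u \<in> side ET x y \<longleftrightarrow> w \<in> side ET x y"
  using side(3)[OF assms(1,2)] assms(3) by (auto simp: crosses_pair)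

text \<open>The union of \<open>q\<close> and all sides seen from it has no leaving edge: an edge
  leaving at \<open>q\<close> leads to a neighbour that lies in its own side, and a side can be left
  only towards \<open>q\<close>.\<close>

lemma side_cover:
  assumes "q \<in> VT" "v \<in> VT" "v \<noteq> q"
  obtains y where "{q, y} \<in> ET" "v \<in> side ET q y"
proof -
  define U where "U = insert q (\<Union>y \<in> {y. {q, y} \<in> ET}. side ET q y)"
  have "VT \<subseteq> U"
  proof (rule ccontr)
    assume "\<not> VT \<subseteq> U"
    moreover have "VT \<inter> U \<noteq> {}" using assms by (auto simp: U_def)
    ultimately obtain e where e: "e \<in> ET" "crosses e U" using cut by blast
    obtain s t where st: "e = {s, t}" "s \<in> U" "t \<notin> U"
      using e graph_edgeE[OF graph e(1)] by (metis crosses_pair insert_commute)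
    then have "s \<noteq> q" using e side(1)[of q t] by (auto simp: U_def)
    then obtain y where y: "{q, y} \<in> ET" "s \<in> side ET q y" using st by (auto simp: U_def)
    then have "t \<in> side ET q y \<or> {s, t} = {q, y}" using side_edge[OF y(1)] st e by blast
    then show False using st y \<open>s \<noteq> q\<close> by (auto simp: U_def doubleton_eq_iff)
  qed
  then show ?thesis using assms that by (auto simp: U_def)
qed

text \<open>Seen from \<open>q\<close>, the edge \<open>f\<close> lies in the branch towards some
  \<open>y\<close>, or is \<open>{q, y}\<close> itself; a path through \<open>q\<close> and
  \<open>f\<close> must enter that branch over \<open>{q, y}\<close>. The choice of \<open>y\<close>
  depends on \<open>f\<close> only, so an edge common to several paths through \<open>q\<close> can
  be replaced by a common edge at \<open>q\<close>.\<close>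

lemma path_edge_at:
  assumes "q \<in> VT" "f \<in> ET"
  obtains y where "{q, y} \<in> ET"
    "\<And>ps. is_path VT ET ps \<Longrightarrow> q \<in> set ps \<Longrightarrow> f \<in> path_edges ps \<Longrightarrow> {q, y} \<in> path_edges ps"
proof (cases "q \<in> f")
  case True
  then obtain y where "f = {q, y}" using graph_edgeE[OF graph assms(2)]
    by (metis insertE insert_commute singletonD)
  then show ?thesis using that assms by blast
next
  case False
  obtain s t where st: "f = {s, t}" "s \<in> VT" using graph_edgeE[OF graph assms(2)] .
  with False obtain y where y: "{q, y} \<in> ET" "s \<in> side ET q y"
    using side_cover[OF assms(1), of s] by auto
  have "{q, y} \<in> path_edges ps"
    if ps: "is_path VT ET ps" "q \<in> set ps" "f \<in> path_edges ps" for ps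
  proof -
    have "s \<in> set ps" using path_edges_subset[OF ps(3)] st by auto
    then have "\<exists>e \<in> path_edges ps. crosses e (side ET q y)"
      using ps(2) y side(2)[OF y(1)] by (intro path_crosses) auto
    then show ?thesis using side(3)[OF y(1)] ps(1) unfolding is_path_def by blast
  qed
  then show ?thesis using that y(1) by blast
qed

end

subsection \<open>Gates have no clique separator\<close>

text \<open>Absence of a clique separator in cut form: after deleting a complete set
  \<open>K\<close>, every bipartition of what remains is crossed by an edge. The choice
  \<open>K = {}\<close> gives connectivity.\<close>

definition nonsep :: "'a set \<Rightarrow> 'a set set \<Rightarrow> bool" where
  "nonsep V E \<longleftrightarrow> (\<forall>K A. complete_set E K \<and> (V - K) \<inter> A \<noteq> {} \<and> \<not> V - K \<subseteq> A \<longrightarrow>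
     (\<exists>e\<in>E. e \<subseteq> V - K \<and> crosses e A))"

lemma complete_set_adj: "complete_set E K \<Longrightarrow> u \<in> K \<Longrightarrow> w \<in> K \<Longrightarrow> u \<noteq> w \<Longrightarrow> {u, w} \<in> E"
  by (simp add: complete_set_def)

lemma clique_nonempty:
  assumes "is_clique V E C" "V \<noteq> {}" shows "C \<noteq> {}"
proof
  assume "C = {}"
  obtain v where "v \<in> V" using assms by blast
  then have "{} \<subset> {v} \<and> {v} \<subseteq> V" "complete_set E {v}" by (auto simp: complete_set_def)
  then show False using assms \<open>C = {}\<close> unfolding is_clique_def by blast
qed

lemma gate_graph: "gate V E \<Longrightarrow> graph V E"
proof (induction rule: gate.induct)
  case (cycle cs)
  then obtain x ys where "cs = x # ys" "ys \<noteq> []" by (cases cs; cases "tl cs") auto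
  moreover have "e \<subseteq> set ys \<and> card e = 2" if e: "e \<in> path_edges ys" "distinct ys" for e ys
  proof -
    have "e \<subseteq> set ys" using path_edges_subset[OF e(1)] .
    moreover obtain a b where "e = {a, b}" using e(1) unfolding path_edges_def by blast
    ultimately show ?thesis using path_edge_neq[of ys a b] e by auto
  qed
  ultimately show ?case using cycle
    by (auto simp: graph_def cycle_edges_Cons card_insert_if)
next
  case (extend V E C C' ps)
  have sub: "C \<subseteq> V" "C' \<subseteq> V" using extend by (auto simp: is_clique_def)
  have ps: "hd ps \<in> set ps" "last ps \<in> set ps" using extend by (cases ps; auto)+
  have "e \<subseteq> set ps \<and> card e = 2" if e: "e \<in> path_edges ps" for e
  proof -
    have "e \<subseteq> set ps" using path_edges_subset[OF e(1)] .
    moreover obtain a b where "e = {a, b}" using e(1) unfolding path_edges_def by blast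
    ultimately show ?thesis using path_edge_neq[of ps a b] e extend by auto
  qed
  moreover have "e \<subseteq> V \<and> card e = 2" if "e \<in> E" for e
    using that extend.IH by (auto simp: graph_def)
  moreover have "e \<subseteq> V \<union> set ps \<and> card e = 2" if "e \<in> {{p, c} | c. c \<in> D}" "p \<in> set ps" "D \<subseteq> V" for p D e
    using that extend.hyps by (auto simp: card_insert_if)
  ultimately have "e \<subseteq> V \<union> set ps \<and> card e = 2"
    if "e \<in> E \<union> path_edges ps \<union> {{hd ps, c} | c. c \<in> C} \<union> {{last ps, c} | c. c \<in> C'}" for e
    using that sub ps by (meson Un_iff sup.coboundedI1 sup.coboundedI2)
  then show ?case using extend.IH unfolding graph_def by simp
qed

lemma path_edge_between:
  assumes "set ps \<inter> K = {}" "path_edges ps \<subseteq> E" "set ps \<subseteq> V" "set ps \<inter> A \<noteq> {}" "\<not> set ps \<subseteq> A"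
  shows "\<exists>e\<in>E. e \<subseteq> V - K \<and> crosses e A"
proof -
  obtain e where e: "e \<in> path_edges ps" "crosses e A" using path_crosses assms by metis
  then have "e \<subseteq> V - K" using path_edges_subset[OF e(1)] assms(1,3) by blast
  then show ?thesis using e assms(2) by blast
qed

lemma cycle_adj:
  assumes "distinct cs" "length cs \<ge> 3" "i < j" "j < length cs" "{cs ! i, cs ! j} \<in> cycle_edges cs"
  shows "j = Suc i \<or> i = 0 \<and> Suc j = length cs"
proof -
  let ?n = "length cs"
  obtain k where k: "k < ?n" "{cs ! i, cs ! j} = {cs ! k, cs ! (Suc k mod ?n)}"
    using assms(5) unfolding cycle_edges_def by blast
  have "Suc k mod ?n < ?n" by (rule mod_less_divisor) (use assms in linarith)
  then have "(i = k \<and> j = Suc k mod ?n) \<or> (j = k \<and> i = Suc k mod ?n)"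
    using k assms by (auto simp: doubleton_eq_iff nth_eq_iff_index_eq)
  then show ?thesis using k assms by (cases "Suc k = ?n") auto
qed

text \<open>Vertices on different sides of \<open>A\<close> are joined by two arcs of the cycle. A
  separating \<open>K\<close> would have to meet the interior of both, but vertices from different
  interiors are never consecutive, so \<open>K\<close> would not be complete.\<close>

lemma nonsep_cycle:
  assumes cs: "distinct cs" "length cs \<ge> 4"
  shows "nonsep (set cs) (cycle_edges cs)"
  unfolding nonsep_def
proof (intro allI impI, elim conjE)
  fix K A
  let ?n = "length cs"
  assume K: "complete_set (cycle_edges cs) K" and "(set cs - K) \<inter> A \<noteq> {}" "\<not> set cs - K \<subseteq> A"
  then obtain a b where ab: "a \<in> set cs - K" "b \<in> set cs - K" "(a \<in> A) \<noteq> (b \<in> A)" by blast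
  then obtain i j where ij: "i < j" "j < ?n" "cs ! i \<notin> K" "cs ! j \<notin> K" "(cs ! i \<in> A) \<noteq> (cs ! j \<in> A)"
    by (metis DiffD1 DiffD2 in_set_conv_nth linorder_neqE_nat)
  show "\<exists>e\<in>cycle_edges cs. e \<subseteq> set cs - K \<and> crosses e A"
  proof (rule ccontr)
    assume no: "\<not> ?thesis"
    \<comment> \<open>The two arcs between positions \<open>i\<close> and \<open>j\<close>;
      \<open>p2\<close> is the one that runs over the end of the list.\<close>
    define p1 where "p1 = map ((!) cs) [i..<Suc j]"
    define p2 where "p2 = map ((!) cs) ([j..<?n] @ [0..<Suc i])"
    have e: "{cs ! k, cs ! Suc k} \<in> cycle_edges cs" if "Suc k < ?n" for k
      unfolding cycle_edges_def by (rule CollectI, rule exI[of _ k]) (use that in auto)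
    have e': "{cs ! (?n - 1), cs ! 0} \<in> cycle_edges cs"
    proof -
      have "Suc (?n - 1) = ?n" using cs by linarith
      then have "Suc (?n - 1) mod ?n = 0" by simp
      then show ?thesis
        unfolding cycle_edges_def using cs by (intro CollectI exI[of _ "?n - 1"]) auto
    qed
    have pe: "path_edges (map ((!) cs) [a..<b]) \<subseteq> cycle_edges cs" if "b \<le> ?n" for a b
      unfolding path_edges_def using that by (auto intro!: e)
    have "path_edges p1 \<subseteq> cycle_edges cs" unfolding p1_def using ij by (intro pe) simp
    moreover have "set p1 \<subseteq> set cs" using ij by (auto simp: p1_def)
    moreover have "cs ! i \<in> set p1" "cs ! j \<in> set p1" using ij by (auto simp: p1_def simp del: upt_Suc)
    then have "set p1 \<inter> A \<noteq> {}" "\<not> set p1 \<subseteq> A" using ij(5) by blast+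
    ultimately have "set p1 \<inter> K = {} \<Longrightarrow> \<exists>e\<in>cycle_edges cs. e \<subseteq> set cs - K \<and> crosses e A"
      by (intro path_edge_between)
    then have "set p1 \<inter> K \<noteq> {}" using no by argo
    then obtain k where "cs ! k \<in> K" "i \<le> k" "k < Suc j" by (auto simp: p1_def simp del: upt_Suc)
    then have k: "i < k" "k < j" "cs ! k \<in> K"
      using ij(3,4) by (metis le_neq_implies_less, metis less_antisym, blast)
    have "path_edges p2 \<subseteq> cycle_edges cs"
      unfolding p2_def map_append path_edges_append using ij pe[of ?n j] pe[of "Suc i" 0] e'
      by (auto simp: last_map hd_map simp del: upt_Suc)
    moreover have "set p2 \<subseteq> set cs" using ij by (auto simp: p2_def)
    moreover have "cs ! i \<in> set p2" "cs ! j \<in> set p2" using ij by (auto simp: p2_def simp del: upt_Suc)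
    then have "set p2 \<inter> A \<noteq> {}" "\<not> set p2 \<subseteq> A" using ij(5) by blast+
    ultimately have "set p2 \<inter> K = {} \<Longrightarrow> \<exists>e\<in>cycle_edges cs. e \<subseteq> set cs - K \<and> crosses e A"
      by (intro path_edge_between)
    then have "set p2 \<inter> K \<noteq> {}" using no by argo
    then obtain k' where "cs ! k' \<in> K" "j \<le> k' \<and> k' < ?n \<or> k' < Suc i"
      by (force simp: p2_def simp del: upt_Suc)
    moreover have "k' \<noteq> i" "k' \<noteq> j" using ij(3,4) calculation by auto
    ultimately have k': "k' < i \<or> j < k'" "k' < ?n" "cs ! k' \<in> K"
      using ij(1,2) by auto
    have ne: "cs ! k \<noteq> cs ! k'" using k k' ij cs by (auto simp: nth_eq_iff_index_eq)
    then have adj: "{cs ! k, cs ! k'} \<in> cycle_edges cs" "{cs ! k', cs ! k} \<in> cycle_edges cs"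
      using complete_set_adj[OF K] k k' by auto
    from k'(1) show False
    proof
      assume "k' < i"
      then show False using cycle_adj[of cs k' k] adj k ij cs by auto
    next
      assume "j < k'"
      then show False using cycle_adj[of cs k k'] adj k k' ij cs by auto
    qed
  qed
qed

text \<open>Old vertices stay together since \<open>K \<inter> V\<close> is complete in the old
  graph. A new vertex can reach the old part in two directions, through \<open>C\<close> and through
  \<open>C'\<close>. Blocking both takes either two nonadjacent members of \<open>K\<close> or all
  of \<open>C \<union> C'\<close>, and neither is possible.\<close>

lemma nonsep_extend:
  assumes g: "graph V E" and ns: "nonsep V E"
    and C: "is_clique V E C" and C': "is_clique V E C'" and dj: "C \<inter> C' = {}"
    and ps: "distinct ps" "length ps \<ge> 2" "set ps \<inter> V = {}"
    and ne: "V \<noteq> {}"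
  defines "E' \<equiv> E \<union> path_edges ps \<union> {{hd ps, c} | c. c \<in> C} \<union> {{last ps, c} | c. c \<in> C'}"
  shows "nonsep (V \<union> set ps) E'"
  unfolding nonsep_def
proof (intro allI impI)
  fix K A
  let ?n = "length ps"
  assume KA: "complete_set E' K \<and> (V \<union> set ps - K) \<inter> A \<noteq> {} \<and> \<not> V \<union> set ps - K \<subseteq> A"
  then have K: "complete_set E' K" by simp
  let ?goal = "\<lambda>A. \<exists>e\<in>E'. e \<subseteq> V \<union> set ps - K \<and> crosses e A"
  have hl: "hd ps \<in> set ps" "last ps \<in> set ps" "hd ps = ps ! 0" "last ps = ps ! (?n - 1)"
    using ps by (cases ps; auto simp: last_conv_nth)+
  have CV: "C \<subseteq> V" "C' \<subseteq> V" using C C' by (auto simp: is_clique_def)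
  have Cne: "C \<noteq> {}" "C' \<noteq> {}" using clique_nonempty[OF C ne] clique_nonempty[OF C' ne] by auto
  have adjVV: "{u, w} \<in> E" if "{u, w} \<in> E'" "u \<in> V" "w \<in> V" for u w
    using that ps(3) hl path_edges_subset[of "{u, w}" ps] by (auto simp: E'_def doubleton_eq_iff)
  have adjPV: "p = hd ps \<and> u \<in> C \<or> p = last ps \<and> u \<in> C'"
    if "{p, u} \<in> E'" "p \<in> set ps" "u \<in> V" for p u
    using that ps(3) graph_edgeD[OF g, of p u] path_edges_subset[of "{p, u}" ps] CV
    by (auto simp: E'_def doubleton_eq_iff)
  have adjPP: "j = Suc i" if ij: "{ps ! i, ps ! j} \<in> E'" "i < j" "j < ?n" for i j
  proof -
    have "ps ! i \<in> set ps" "ps ! j \<in> set ps" using ij by simp_all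
    then have "ps ! i \<notin> V" "ps ! j \<notin> V" using ps(3) by blast+
    moreover have "\<not> {ps ! i, ps ! j} \<subseteq> V \<Longrightarrow> {ps ! i, ps ! j} \<notin> E"
      using g unfolding graph_def by blast
    moreover have "{ps ! i, ps ! j} \<noteq> {p, c}" if "c \<in> V" for p c
      using calculation that by (metis insertI1 insert_commute insert_iff singletonD)
    ultimately have "{ps ! i, ps ! j} \<in> path_edges ps"
      using ij(1) CV unfolding E'_def by auto
    then obtain k where "Suc k < ?n" "{ps ! i, ps ! j} = {ps ! k, ps ! Suc k}"
      by (rule path_edgesE)
    then show ?thesis using ij ps(1) by (auto simp: doubleton_eq_iff nth_eq_iff_index_eq)
  qed
  have KV: "complete_set E (K \<inter> V)"
    using K adjVV unfolding complete_set_def by blast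
  \<comment> \<open>Otherwise \<open>C \<union> C'\<close> would be a complete set properly
    containing the clique \<open>C\<close>.\<close>
  have CK: "\<not> (C \<subseteq> K \<and> C' \<subseteq> K)"
  proof
    assume *: "C \<subseteq> K \<and> C' \<subseteq> K"
    then have "complete_set E (C \<union> C')" using KV CV unfolding complete_set_def by blast
    moreover have "C \<subset> C \<union> C'" using dj Cne by blast
    ultimately show False using C CV unfolding is_clique_def by (meson Un_subset_iff)
  qed
  obtain v0 where v0: "v0 \<in> V" "v0 \<notin> K" using CK CV by blast
  have pe: "path_edges (map ((!) ps) [a..<b]) \<subseteq> E'" if "b \<le> ?n" for a b
    using that unfolding path_edges_def E'_def by auto
  \<comment> \<open>The surviving old vertices may be assumed to lie in \<open>A\<close>; the
    opposite case is this one applied to \<open>- A\<close>.\<close>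
  have main: "?goal A" if VA: "V - K \<subseteq> A" and p: "p \<in> set ps - K" "p \<notin> A" for A p
  proof (rule ccontr)
    assume no: "\<not> ?goal A"
    obtain i where i: "i < ?n" "p = ps ! i" using p by (metis DiffD1 in_set_conv_nth)
    have left: "C \<subseteq> K \<or> (\<exists>k<i. ps ! k \<in> K)"
    proof (rule ccontr)
      assume n: "\<not> ?thesis"
      then obtain c where c: "c \<in> C" "c \<notin> K" by blast
      define l where "l = c # map ((!) ps) [0..<Suc i]"
      have "path_edges l \<subseteq> E'" using pe[of "Suc i" 0] i c hl
        by (auto simp: l_def path_edges_Cons hd_map E'_def insert_commute simp del: upt_Suc)
      moreover have "set l \<inter> K = {}" using n c i p by (auto simp: l_def less_Suc_eq simp del: upt_Suc)
      moreover have "set l \<subseteq> V \<union> set ps" using c CV i by (auto simp: l_def simp del: upt_Suc)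
      moreover have "c \<in> A" using VA c CV by blast
      moreover have "p \<in> set l" using i by (auto simp: l_def simp del: upt_Suc)
      moreover have "c \<in> set l" by (simp add: l_def)
      ultimately have "set l \<inter> A \<noteq> {}" "\<not> set l \<subseteq> A" "path_edges l \<subseteq> E'" "set l \<inter> K = {}" "set l \<subseteq> V \<union> set ps"
        using p by blast+
      then have "?goal A" by (intro path_edge_between)
      then show False using no by contradiction
    qed
    have right: "C' \<subseteq> K \<or> (\<exists>k. i < k \<and> k < ?n \<and> ps ! k \<in> K)"
    proof (rule ccontr)
      assume n: "\<not> ?thesis"
      then obtain c where c: "c \<in> C'" "c \<notin> K" by blast
      define l where "l = map ((!) ps) [i..<?n] @ [c]"
      have "path_edges l \<subseteq> E'" unfolding l_def path_edges_append using pe[of ?n i] i c hl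
        by (auto simp: last_map E'_def)
      moreover have "set l \<inter> K = {}" using n c i p le_neq_implies_less[of i] by (auto simp: l_def)
      moreover have "set l \<subseteq> V \<union> set ps" using c CV i by (auto simp: l_def)
      moreover have "c \<in> A" using VA c CV by blast
      moreover have "p \<in> set l" using i by (auto simp: l_def simp del: upt_Suc)
      moreover have "c \<in> set l" by (simp add: l_def)
      ultimately have "set l \<inter> A \<noteq> {}" "\<not> set l \<subseteq> A" "path_edges l \<subseteq> E'" "set l \<inter> K = {}" "set l \<subseteq> V \<union> set ps"
        using p by blast+
      then have "?goal A" by (intro path_edge_between)
      then show False using no by contradiction
    qed
    have adjK: "{u, w} \<in> E'" if "u \<in> K" "w \<in> K" "u \<noteq> w" for u w
      using complete_set_adj[OF K] that by blast
    show False
    proof (cases "\<exists>k<i. ps ! k \<in> K")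
      case True
      then obtain k where k: "k < i" "ps ! k \<in> K" by blast
      show False
      proof (cases "\<exists>k. i < k \<and> k < ?n \<and> ps ! k \<in> K")
        case True
        then obtain k' where k': "i < k'" "k' < ?n" "ps ! k' \<in> K" by blast
        then have "ps ! k \<noteq> ps ! k'" using k ps(1) by (auto simp: nth_eq_iff_index_eq)
        then have "k' = Suc k" using adjPP[of k k'] adjK k k' by simp
        then show False using k k' by simp
      next
        case False
        then obtain c where c: "c \<in> C'" "c \<in> K" using right Cne by blast
        have kp: "ps ! k \<in> set ps" using k i by simp
        then have "ps ! k \<noteq> c" using c CV ps(3) by blast
        then have "ps ! k = last ps" using adjPV[of "ps ! k" c] adjK k c kp CV dj by blast
        then have "k = ?n - 1" using ps(1) hl k i by (auto simp: nth_eq_iff_index_eq)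
        then show False using k i by simp
      qed
    next
      case False
      then have "C \<subseteq> K" using left by blast
      then obtain k where k: "i < k" "k < ?n" "ps ! k \<in> K" using right CK by blast
      obtain c where c: "c \<in> C" "c \<in> K" using \<open>C \<subseteq> K\<close> Cne by blast
      have kp: "ps ! k \<in> set ps" using k i by simp
      then have "ps ! k \<noteq> c" using c CV ps(3) by blast
      then have "ps ! k = hd ps" using adjPV[of "ps ! k" c] adjK k c kp CV dj by blast
      moreover have "0 < ?n" using k by linarith
      ultimately have "k = 0" using nth_eq_iff_index_eq[OF ps(1), of k 0] hl k by simp
      then show False using k i by simp
    qed
  qed
  show "?goal A"
  proof (cases "(V - K) \<inter> A \<noteq> {} \<and> \<not> V - K \<subseteq> A")
    case True
    then have "(V - K \<inter> V) \<inter> A \<noteq> {} \<and> \<not> V - K \<inter> V \<subseteq> A" by blast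
    then obtain e where "e \<in> E" "e \<subseteq> V - K \<inter> V" "crosses e A"
      using ns KV unfolding nonsep_def by meson
    then show ?thesis by (intro bexI[of _ e]) (auto simp: E'_def)
  next
    case False
    then consider "V - K \<subseteq> A" | "V - K \<subseteq> - A" by blast
    then show ?thesis
    proof cases
      case 1
      then obtain p where "p \<in> set ps - K" "p \<notin> A" using KA by blast
      then show ?thesis using main 1 by blast
    next
      case 2
      then obtain p where "p \<in> set ps - K" "p \<notin> - A" using KA by blast
      then show ?thesis using main[of "- A" p] 2 by simp
    qed
  qed
qed

lemma gate_nonempty: "gate V E \<Longrightarrow> V \<noteq> {}"
  by (induction rule: gate.induct) auto

lemma gate_nonsep: "gate V E \<Longrightarrow> nonsep V E"
proof (induction rule: gate.induct)
  case (cycle cs)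
  then show ?case by (rule nonsep_cycle)
next
  case (extend V E C C' ps)
  then show ?case
    by (intro nonsep_extend) (auto intro: gate_graph dest: gate_nonempty)
qed

subsection \<open>The centre of a representation\<close>

context tree
begin

text \<open>An edge crossing the intersection crosses one of the two sides and is therefore
  \<open>{x, y}\<close>, but neither of its ends lies in both sides.\<close>

lemma sides_disjoint:
  assumes xy: "{x, y} \<in> ET"
  shows "side ET x y \<inter> side ET y x \<inter> VT = {}"
proof (rule ccontr)
  assume ne: "\<not> ?thesis"
  have yx: "{y, x} \<in> ET" using xy by (simp add: insert_commute)
  let ?I = "side ET x y \<inter> side ET y x"
  have "\<not> VT \<subseteq> ?I" using side(2)[OF xy] graph_edgeD[OF graph xy] by blast
  then obtain e where e: "e \<in> ET" "crosses e ?I" using ne cut[of ?I] by blast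
  then have "crosses e (side ET x y) \<or> crosses e (side ET y x)" by (auto simp: crosses_def)
  then have "e = {x, y}" using side(3)[OF xy] side(3)[OF yx] e by (auto simp: insert_commute)
  then show False using e(2) side(2)[OF xy] side(2)[OF yx] by (auto simp: crosses_pair)
qed

text \<open>Walking along the tree without turning back strictly shrinks the part ahead; the search
  for a sink terminates for this reason.\<close>

lemma side_nested:
  assumes xy: "{x, y} \<in> ET" and yw: "{y, w} \<in> ET" and "w \<noteq> x"
  shows "side ET y w \<inter> VT \<subset> side ET x y \<inter> VT"
proof -
  let ?I = "side ET y w - side ET x y"
  have ne: "{y, w} \<noteq> {x, y}" using assms by (auto simp: doubleton_eq_iff)
  have w: "w \<in> side ET x y" using side_edge[OF xy yw ne] side(1)[OF xy] by simp
  have x: "x \<notin> side ET y w"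
    using side_edge[OF yw xy] ne side(2)[OF yw] by auto
  have "VT \<inter> ?I = {}"
  proof (rule ccontr)
    assume n: "VT \<inter> ?I \<noteq> {}"
    have "\<not> VT \<subseteq> ?I" using side(1)[OF xy] graph_edgeD[OF graph xy] by blast
    then obtain e where e: "e \<in> ET" "crosses e ?I" using n cut[of ?I] by blast
    then have "crosses e (side ET x y) \<or> crosses e (side ET y w)" by (auto simp: crosses_def)
    then have "e = {x, y} \<or> e = {y, w}" using side(3)[OF xy] side(3)[OF yw] e by auto
    then show False using e(2) w x side(1)[OF xy] by (auto simp: crosses_pair)
  qed
  moreover have "y \<in> side ET x y \<inter> VT" "y \<notin> side ET y w"
    using side(1)[OF xy] side(2)[OF yw] graph_edgeD[OF graph xy] by auto
  ultimately show ?thesis by blast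
qed

text \<open>Orient each tree edge towards the side containing the paths that avoid it; a clique
  separator is exactly what could make this ambiguous. A sink of the orientation is a centre.\<close>
lemma centre:
  assumes rep: "ept_rep S E VT ET P" and ns: "nonsep S E" and g: "graph S E"
  obtains q where "q \<in> VT" "\<And>v. v \<in> S \<Longrightarrow> q \<in> set (P v)"
proof -
  have path: "is_path VT ET (P v)" if "v \<in> S" for v
    using rep that by (auto simp: ept_rep_def tree_subpath_def)
  have adj: "{v, w} \<in> E \<longleftrightarrow> path_edges (P v) \<inter> path_edges (P w) \<noteq> {}"
    if "v \<in> S" "w \<in> S" "v \<noteq> w" for v w
    using rep that by (auto simp: ept_rep_def)
  define to where "to x y \<longleftrightarrow> {x, y} \<in> ET \<and>
    (\<forall>v\<in>S. {x, y} \<in> path_edges (P v) \<or> set (P v) \<subseteq> side ET x y)" for x y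
  have one_side: "set (P v) \<subseteq> side ET x y \<or> set (P v) \<inter> side ET x y = {}"
    if "v \<in> S" "{x, y} \<in> ET" "{x, y} \<notin> path_edges (P v)" for v x y
    using path_crosses[of "P v" "side ET x y"] side(3)[OF that(2)] path[OF that(1)] that(3)
    unfolding is_path_def by blast
  \<comment> \<open>The paths through \<open>{x, y}\<close> share that edge, so their indices form a
    complete set \<open>K\<close>. If paths avoiding the edge occurred on both sides,
    \<open>K\<close> would separate their indices.\<close>
  have not_to: "{x, y} \<in> path_edges (P v) \<or> set (P v) \<inter> side ET x y = {}"
    if xy: "{x, y} \<in> ET" and nt: "\<not> to x y" and v: "v \<in> S" for x y v
  proof (rule ccontr)
    assume n: "\<not> ?thesis"
    define K where "K = {u \<in> S. {x, y} \<in> path_edges (P u)}"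
    define A where "A = {u. set (P u) \<subseteq> side ET x y}"
    obtain u where "u \<in> S" "{x, y} \<notin> path_edges (P u)" "\<not> set (P u) \<subseteq> side ET x y"
      using nt xy unfolding to_def by blast
    then have u: "u \<in> S - K" "u \<notin> A" by (auto simp: K_def A_def)
    have v': "v \<in> S - K" "v \<in> A" using n one_side[OF v xy] v by (auto simp: K_def A_def)
    have "complete_set E K"
      unfolding complete_set_def using adj by (auto simp: K_def)
    moreover have "(S - K) \<inter> A \<noteq> {}" "\<not> S - K \<subseteq> A" using u v' by blast+
    ultimately obtain e where e: "e \<in> E" "e \<subseteq> S - K" "crosses e A"
      using ns unfolding nonsep_def by meson
    obtain a b where ab: "e = {a, b}" "a \<noteq> b" using graph_edgeE[OF g e(1)] by metis
    then obtain f where f: "f \<in> path_edges (P a)" "f \<in> path_edges (P b)"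
      using adj[of a b] e by auto
    have "f \<noteq> {}" using f(1) by (auto simp: path_edges_def)
    then obtain t where "t \<in> set (P a)" "t \<in> set (P b)"
      using path_edges_subset f by blast
    moreover have "set (P a) \<subseteq> side ET x y \<or> set (P a) \<inter> side ET x y = {}"
      "set (P b) \<subseteq> side ET x y \<or> set (P b) \<inter> side ET x y = {}"
      using one_side[OF _ xy] e ab by (auto simp: K_def)
    ultimately show False using e(3) unfolding ab(1) crosses_pair A_def by blast
  qed
  have "\<exists>q\<in>VT. \<forall>v\<in>S. q \<in> set (P v)"
  proof (cases "\<exists>q\<in>VT. \<forall>y. \<not> to q y")
    case True
    then obtain q where q: "q \<in> VT" "\<And>y. \<not> to q y" by blast
    have "q \<in> set (P v)" if v: "v \<in> S" for v
    proof (rule ccontr)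
      assume nq: "q \<notin> set (P v)"
      obtain u where u: "u \<in> set (P v)" "u \<in> VT"
        using path[OF v] by (metis is_path_def last_in_set subsetD)
      then obtain y where y: "{q, y} \<in> ET" "u \<in> side ET q y" using side_cover[OF q(1)] nq by metis
      have "{q, y} \<notin> path_edges (P v)" using nq path_edge_in_set by metis
      then show False using not_to[OF y(1) q(2) v] u y by blast
    qed
    then show ?thesis using q by blast
  next
    case False
    \<comment> \<open>Without a sink every vertex has an outgoing edge. An oriented edge with the
      smallest part ahead can only be continued by its own reversal, and an edge oriented both ways
      lies on every path.\<close>
    define M where "M = (\<lambda>(x, y). card (side ET x y \<inter> VT))"
    obtain q0 where "q0 \<in> VT" using nonempty by blast
    then have "\<exists>p. case p of (x, y) \<Rightarrow> to x y" using False by fast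
    then obtain p where p: "case p of (x, y) \<Rightarrow> to x y"
      and min: "\<And>p'. (case p' of (x, y) \<Rightarrow> to x y) \<Longrightarrow> M p \<le> M p'"
      using exists_least_iff[of "\<lambda>n. \<exists>p. (case p of (x, y) \<Rightarrow> to x y) \<and> M p = n"]
      by (metis not_le_imp_less)
    obtain x y where xy: "p = (x, y)" by fastforce
    then have to: "to x y" and xyE: "{x, y} \<in> ET" using p by (auto simp: to_def)
    have V: "x \<in> VT" "y \<in> VT" using graph_edgeD[OF graph xyE] by auto
    then obtain w where w: "to y w" using False by blast
    then have yw: "{y, w} \<in> ET" by (simp add: to_def)
    have "w = x"
    proof (rule ccontr)
      assume "w \<noteq> x"
      then have "M (y, w) < M (x, y)"
        unfolding M_def using side_nested[OF xyE yw] finite_VT by (simp add: psubset_card_mono)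
      then show False using min[of "(y, w)"] w xy by simp
    qed
    have "{x, y} \<in> path_edges (P v)" if v: "v \<in> S" for v
    proof (rule ccontr)
      assume "{x, y} \<notin> path_edges (P v)"
      then have "set (P v) \<subseteq> side ET x y \<inter> side ET y x \<inter> VT"
        using to w v path[OF v] \<open>w = x\<close> unfolding to_def is_path_def
        by (metis Int_subset_iff insert_commute)
      then show False using path[OF v] sides_disjoint[OF xyE] by (auto simp: is_path_def)
    qed
    then show ?thesis using V path_edge_in_set by metis
  qed
  then show ?thesis using that by blast
qed

lemma degree_nbrs: "q \<in> VT \<Longrightarrow> degree ET q = card {x. {q, x} \<in> ET}"
proof -
  have "{e \<in> ET. q \<in> e} = (\<lambda>x. {q, x}) ` {x. {q, x} \<in> ET}"
  proof (intro equalityI subsetI)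
    fix e assume "e \<in> {e \<in> ET. q \<in> e}"
    then have e: "e \<in> ET" "q \<in> e" by auto
    obtain x y where "e = {x, y}" using graph_edgeE[OF graph e(1)] .
    then have "e = {q, x} \<or> e = {q, y}" using e(2) by auto
    then show "e \<in> (\<lambda>x. {q, x}) ` {x. {q, x} \<in> ET}" using e(1) by auto
  qed auto
  moreover have "inj_on (\<lambda>x. {q, x}) {x. {q, x} \<in> ET}"
    by (auto simp: inj_on_def doubleton_eq_iff)
  ultimately show ?thesis unfolding degree_def by (simp add: card_image)
qed

lemma finite_nbrs: "finite {x. {q, x} \<in> ET}"
  using graph_edgeD(3)[OF graph] by (intro finite_subset[OF _ finite_VT]) blast

end

text \<open>The Helly property gives a clique a common tree edge, which can be moved to an edge
  \<open>{q, x}\<close> at the centre. All paths through \<open>{q, x}\<close> form a complete set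
  \<open>st x\<close>, so maximality makes the clique equal to it. Hence every clique is a value of
  \<open>st\<close> on the neighbours of \<open>q\<close>.\<close>

lemma clique_number_le_max_degree:
  assumes rep: "helly_ept_rep S E VT ET P" and ns: "nonsep S E" and g: "graph S E" and ne: "S \<noteq> {}"
  shows "card (cliques S E) \<le> max_degree VT ET"
proof -
  have ept: "ept_rep S E VT ET P" and helly: "helly_family S (\<lambda>v. path_edges (P v))"
    using rep by (auto simp: helly_ept_rep_def)
  interpret tree VT ET using ept by unfold_locales (simp add: ept_rep_def)
  obtain q where q: "q \<in> VT" "\<And>v. v \<in> S \<Longrightarrow> q \<in> set (P v)" using centre[OF ept ns g] by blast
  have path: "is_path VT ET (P v)" "length (P v) \<ge> 2" if "v \<in> S" for v
    using ept that by (auto simp: ept_rep_def tree_subpath_def)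
  define st where "st x = {v \<in> S. {q, x} \<in> path_edges (P v)}" for x
  have "K \<in> st ` {x. {q, x} \<in> ET}" if "K \<in> cliques S E" for K
  proof -
    have K: "is_clique S E K" using that by (simp add: cliques_def)
    then have KS: "K \<subseteq> S" "complete_set E K" "K \<noteq> {}"
      using clique_nonempty[OF K ne] by (auto simp: is_clique_def)
    have "path_edges (P v) \<inter> path_edges (P w) \<noteq> {}" if "v \<in> K" "w \<in> K" for v w
    proof (cases "v = w")
      case True
      then show ?thesis using path_edges_nonempty path that KS by auto
    next
      case False
      then have "{v, w} \<in> E" using KS that by (simp add: complete_set_def)
      then show ?thesis using ept KS that False unfolding ept_rep_def by blast
    qed
    then have "(\<Inter>v\<in>K. path_edges (P v)) \<noteq> {}"
      using helly KS(1,3) unfolding helly_family_def by (metis (no_types, lifting))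
    then obtain f where "f \<in> (\<Inter>v\<in>K. path_edges (P v))" by (meson equals0I)
    then have f: "f \<in> path_edges (P v)" if "v \<in> K" for v using that by simp
    obtain v where "v \<in> K" using KS(3) by blast
    then have fET: "f \<in> ET" using f KS(1) path(1)[of v] unfolding is_path_def by blast
    obtain x where x: "{q, x} \<in> ET"
      "\<And>ps. is_path VT ET ps \<Longrightarrow> q \<in> set ps \<Longrightarrow> f \<in> path_edges ps \<Longrightarrow> {q, x} \<in> path_edges ps"
      by (rule path_edge_at[OF q(1) fET], rule that) blast+
    have "K \<subseteq> st x" using x(2) f path(1) q(2) KS(1) unfolding st_def by blast
    moreover have "complete_set E (st x)"
      using ept unfolding complete_set_def st_def ept_rep_def by blast
    ultimately have "K = st x" using K unfolding is_clique_def st_def by blast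
    then show ?thesis using x(1) by blast
  qed
  then have "card (cliques S E) \<le> card {x. {q, x} \<in> ET}"
    by (intro surj_card_le[OF finite_nbrs]) blast
  also have "\<dots> = degree ET q" using degree_nbrs[OF q(1)] by simp
  also have "\<dots> \<le> max_degree VT ET" unfolding max_degree_def using finite_VT q by simp
  finally show ?thesis .
qed

section \<open>Induced gates bound the host degree from below\<close>

lemma helly_ept_rep_induced:
  assumes "helly_ept_rep V E VT ET P" "S \<subseteq> V"
  shows "helly_ept_rep S (induced_edges E S) VT ET P"
proof -
  have "ept_rep S (induced_edges E S) VT ET P"
    using assms unfolding helly_ept_rep_def ept_rep_def induced_edges_def by (simp add: subset_iff)
  moreover have "helly_family S (\<lambda>v. path_edges (P v))"
    using assms unfolding helly_ept_rep_def helly_family_def by (meson order_trans)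
  ultimately show ?thesis by (simp add: helly_ept_rep_def)
qed

lemma k_gate_imp_not_helly_h22:
  assumes gate: "has_induced_k_gate V E k" and h: "h < k"
  shows "\<not> helly_h22 V E h"
proof
  assume "helly_h22 V E h"
  then obtain VT :: "nat set" and ET P where rep: "helly_ept_rep V E VT ET P" "max_degree VT ET = h"
    unfolding helly_h22_def by blast
  obtain S where S: "S \<subseteq> V" "gate S (induced_edges E S)" "card (cliques S (induced_edges E S)) = k"
    using gate unfolding has_induced_k_gate_def k_gate_def by blast
  have "k \<le> max_degree VT ET"
    using clique_number_le_max_degree[OF helly_ept_rep_induced[OF rep(1) S(1)]]
      gate_nonsep[OF S(2)] gate_graph[OF S(2)] gate_nonempty[OF S(2)] S(3) by simp
  then show False using rep h by simp
qed

subsection \<open>Gates as line graphs of minimally 2-connected graphs\<close>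

definition twoconn :: "'b set \<Rightarrow> 'b set set \<Rightarrow> bool" where
  "twoconn N F \<longleftrightarrow> (\<forall>a\<in>N. \<forall>A. (N - {a}) \<inter> A \<noteq> {} \<and> \<not> N - {a} \<subseteq> A \<longrightarrow>
     (\<exists>f\<in>F. a \<notin> f \<and> crosses f A))"

lemma twoconnD:
  assumes "twoconn N F" "a \<in> N" "u \<in> N - {a}" "u \<in> A" "w \<in> N - {a}" "w \<notin> A"
  obtains f where "f \<in> F" "a \<notin> f" "crosses f A"
proof -
  have "(N - {a}) \<inter> A \<noteq> {} \<and> \<not> N - {a} \<subseteq> A" using assms by blast
  then show ?thesis using assms(1,2) that unfolding twoconn_def by metis
qed

lemma card2E:
  assumes "card f = 2" "x \<in> f" obtains a where "f = {x, a}" "a \<noteq> x"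
  using assms by (auto simp: card_2_iff insert_commute)

text \<open>As \<open>us\<close> is nonempty, every edge of the ear touches an inner vertex. Ear
  edges are therefore new compared with edges inside \<open>X\<close>.\<close>

lemma ear_leaves:
  assumes "us \<noteq> []" "set us \<inter> X = {}" "g \<in> path_edges (c # us @ [d])"
  shows "\<not> g \<subseteq> X"
proof -
  have "g \<in> path_edges us \<or> g = {c, hd us} \<or> g = {last us, d}"
    using assms(1,3) by (auto simp: path_edges_Cons path_edges_append)
  moreover have "hd us \<notin> X" "last us \<notin> X" using assms(1,2) hd_in_set last_in_set by blast+
  moreover have "g \<subseteq> set us \<and> g \<noteq> {}" if "g \<in> path_edges us"
    using path_edges_subset[OF that] that by (auto simp: path_edges_def)
  ultimately show ?thesis using assms(2) by blast
qed

text \<open>Both ends lie on the other side of the cut than \<open>u\<close>, so each of the two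
  segments meeting at \<open>u\<close> crosses it. The segments share only \<open>u\<close>, so the
  two crossing edges differ.\<close>

lemma ear_crosses_twice:
  assumes "distinct (c # us @ [d])" "(c \<in> A) = (d \<in> A)" "u \<in> set us" "(u \<in> A) \<noteq> (c \<in> A)"
  shows "\<exists>f \<in> path_edges (c # us @ [d]). \<exists>g \<in> path_edges (c # us @ [d]).
    f \<noteq> g \<and> crosses f A \<and> crosses g A"
proof -
  obtain l1 l2 where us: "us = l1 @ u # l2" using assms(3) by (meson split_list)
  let ?p = "c # l1 @ [u]" and ?q = "u # l2 @ [d]"
  have sub: "path_edges ?p \<union> path_edges ?q \<subseteq> path_edges (c # us @ [d])"
    unfolding us by (auto simp: path_edges_Cons path_edges_append)
  have "set ?p \<inter> A \<noteq> {}" "\<not> set ?p \<subseteq> A" "set ?q \<inter> A \<noteq> {}" "\<not> set ?q \<subseteq> A" 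
    using assms(2,4) by (cases "u \<in> A"; simp)+
  then obtain f g where f: "f \<in> path_edges ?p" "crosses f A" and g: "g \<in> path_edges ?q" "crosses g A"
    using path_crosses[of ?p A] path_crosses[of ?q A] by metis
  have "f \<noteq> g"
  proof
    assume "f = g"
    then have "f \<subseteq> set ?p \<inter> set ?q"
      using path_edges_subset[OF f(1)] path_edges_subset[OF g(1)] by blast
    moreover have "set ?p \<inter> set ?q = {u}" using assms(1) us by auto
    ultimately have "f \<subseteq> {u}" by argo
    then show False using f(2) by (auto simp: crosses_def)
  qed
  then show ?thesis using f g sub by blast
qed

text \<open>The order is kept because these edges, as vertices of the line graph, form the path that
  extends a gate.\<close>

definition edge_list :: "'b list \<Rightarrow> 'b set list" where
  "edge_list ws = map (\<lambda>i. {ws ! i, ws ! Suc i}) [0..<length ws - 1]"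

lemma set_edge_list: "set (edge_list ws) = path_edges ws"
  by (auto simp: edge_list_def path_edges_def)

lemma length_edge_list [simp]: "length (edge_list ws) = length ws - 1"
  by (simp add: edge_list_def)

lemma nth_edge_list: "i < length ws - 1 \<Longrightarrow> edge_list ws ! i = {ws ! i, ws ! Suc i}"
  by (simp add: edge_list_def)

lemma edge_list_meet:
  assumes "distinct ws" "i < length ws - 1" "j < length ws - 1"
  shows "edge_list ws ! i \<inter> edge_list ws ! j \<noteq> {} \<longleftrightarrow> i = j \<or> i = Suc j \<or> j = Suc i"
  using assms by (auto simp: nth_edge_list nth_eq_iff_index_eq)

lemma distinct_edge_list:
  assumes "distinct ws" shows "distinct (edge_list ws)"
proof -
  have "i = j" if "i < length ws - 1" "j < length ws - 1" "edge_list ws ! i = edge_list ws ! j" for i j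
    using that assms by (auto simp: nth_edge_list doubleton_eq_iff nth_eq_iff_index_eq)
  then show ?thesis by (auto simp: distinct_conv_nth)
qed

text \<open>Inner vertices are new, so only the first and the last edge of an ear can meet old
  edges, at \<open>c\<close> and at \<open>d\<close>: the attachment pattern of
  \<open>gate.extend\<close>.\<close>

lemma edge_list_meet_base:
  assumes "distinct (c # us @ [d])" "us \<noteq> []" "set us \<inter> X = {}" "f \<subseteq> X" "i < length us + 1"
  shows "edge_list (c # us @ [d]) ! i \<inter> f \<noteq> {} \<longleftrightarrow> i = 0 \<and> c \<in> f \<or> i = length us \<and> d \<in> f"
proof -
  let ?ws = "c # us @ [d]"
  have "?ws ! k \<in> f \<longleftrightarrow> k = 0 \<and> c \<in> f \<or> k = Suc (length us) \<and> d \<in> f" if "k < length us + 2" for k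
  proof -
    consider "k = 0" | m where "k = Suc m" "m < length us" | "k = Suc (length us)"
      using \<open>k < _\<close> by (metis Suc_less_SucD add_2_eq_Suc' less_Suc_eq not0_implies_Suc)
    then show ?thesis
    proof cases
      case (2 m)
      then have "us ! m \<notin> f" using assms(3,4) nth_mem[of m us] by blast
      then show ?thesis using 2 by (simp add: nth_append)
    qed (auto simp: nth_append)
  qed
  from this[of i] this[of "Suc i"] show ?thesis
    using assms(2,5) nth_edge_list[of i ?ws] by auto
qed

text \<open>\<open>(N, F)\<close> stands for the local graph, and \<open>\<phi>\<close> names for
  each of its edges a vertex of the represented graph. By \<open>adj\<close>, the image of
  \<open>\<phi>\<close> induces the line graph of \<open>(N, F)\<close>.\<close>

locale root_graph =
  fixes N :: "'b set" and F :: "'b set set" and \<phi> :: "'b set \<Rightarrow> 'a" and E :: "'a set set"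
  assumes graph_root: "graph N F"
    and card_N: "card N \<ge> 4"
    and twoconn: "twoconn N F"
    and minimal: "\<And>e. e \<in> F \<Longrightarrow> \<not> twoconn N (F - {e})"
    and triangle_free: "\<And>x y z. {x, y} \<in> F \<Longrightarrow> {y, z} \<in> F \<Longrightarrow> {x, z} \<in> F \<Longrightarrow> False"
    and inj: "inj_on \<phi> F"
    and adj: "\<And>f g. f \<in> F \<Longrightarrow> g \<in> F \<Longrightarrow> f \<noteq> g \<Longrightarrow> {\<phi> f, \<phi> g} \<in> E \<longleftrightarrow> f \<inter> g \<noteq> {}"
    and card_E: "\<And>e. e \<in> E \<Longrightarrow> card e = 2"
begin

lemma finite_N: "finite N"
  using graph_root by (simp add: graph_def)

lemma edge: "f \<in> F \<Longrightarrow> f \<subseteq> N \<and> card f = 2"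
  using graph_root by (auto simp: graph_def)

section \<open>The line graph as an induced subgraph\<close>

definition line_edges :: "'b set set \<Rightarrow> 'a set set" where
  "line_edges G = induced_edges E (\<phi> ` G)"

lemma line_edges_iff:
  assumes "G \<subseteq> F"
  shows "e \<in> line_edges G \<longleftrightarrow> (\<exists>f\<in>G. \<exists>g\<in>G. f \<noteq> g \<and> f \<inter> g \<noteq> {} \<and> e = {\<phi> f, \<phi> g})"
proof
  assume e: "e \<in> line_edges G"
  then have "e \<in> E" "e \<subseteq> \<phi> ` G" by (auto simp: line_edges_def induced_edges_def)
  then obtain a b where "e = {a, b}" "a \<noteq> b" using card_E by (metis card_2_iff)
  then obtain f g where "f \<in> G" "g \<in> G" "f \<noteq> g" "e = {\<phi> f, \<phi> g}" using \<open>e \<subseteq> _\<close> by auto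
  then show "\<exists>f\<in>G. \<exists>g\<in>G. f \<noteq> g \<and> f \<inter> g \<noteq> {} \<and> e = {\<phi> f, \<phi> g}"
    using adj[of f g] \<open>e \<in> E\<close> assms by blast
next
  assume "\<exists>f\<in>G. \<exists>g\<in>G. f \<noteq> g \<and> f \<inter> g \<noteq> {} \<and> e = {\<phi> f, \<phi> g}"
  then obtain f g where "f \<in> G" "g \<in> G" "f \<noteq> g" "f \<inter> g \<noteq> {}" "e = {\<phi> f, \<phi> g}" by blast
  then show "e \<in> line_edges G"
    using adj[of f g] assms unfolding line_edges_def induced_edges_def by blast
qed

lemma line_edges_pair:
  assumes "G \<subseteq> F" "f \<in> G" "g \<in> G" "f \<noteq> g"
  shows "{\<phi> f, \<phi> g} \<in> line_edges G \<longleftrightarrow> f \<inter> g \<noteq> {}"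
  using assms adj[of f g] unfolding line_edges_def induced_edges_def by auto

text \<open>There is a third vertex besides \<open>u\<close> and \<open>w\<close>; deleting it turns
  2-connectivity into plain connectivity.\<close>

lemma connected:
  assumes "u \<in> N" "u \<in> A" "w \<in> N" "w \<notin> A"
  obtains f where "f \<in> F" "crosses f A"
proof -
  have "N - {u, w} \<noteq> {}"
  proof
    assume "N - {u, w} = {}"
    then have "card N \<le> card {u, w}" by (intro card_mono) auto
    then show False using card_N card_insert_le_m1[of 2 "{w}" u] by simp
  qed
  then obtain a where "a \<in> N - {u, w}" by blast
  then show ?thesis using twoconnD[OF twoconn, of a u A w] assms that by blast
qed

text \<open>Some edge leaves \<open>X\<close> from a vertex \<open>c\<close> to a vertex
  \<open>w\<close>. As \<open>c\<close> is no cut vertex, the component of \<open>w\<close> outside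
  \<open>X\<close> can be left by an edge avoiding \<open>c\<close>; that edge must return to
  \<open>X\<close>, at an end \<open>d\<close> different from \<open>c\<close>.\<close>

lemma ear_exists:
  assumes "X \<subseteq> N" "X \<noteq> N" "x1 \<in> X" "x2 \<in> X" "x1 \<noteq> x2"
  obtains c us d where "c \<in> X" "d \<in> X" "us \<noteq> []" "set us \<subseteq> N - X" "distinct (c # us @ [d])"
    "path_edges (c # us @ [d]) \<subseteq> F"
proof -
  obtain u where "u \<in> N" "u \<notin> X" using assms by blast
  then obtain f where f: "f \<in> F" "crosses f X" using connected[of x1 X u] assms by blast
  then obtain c w where cw: "f = {c, w}" "c \<in> X" "w \<in> N - X"
    using graph_edgeE[OF graph_root f(1)] by (metis DiffI crosses_pair insert_commute)
  let ?R = "reach (N - X) F w"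
  obtain x where x: "x \<in> X" "x \<noteq> c" using assms by metis
  have R: "w \<in> ?R" "?R \<subseteq> N - X" using reach_self[OF cw(3)] reach_subset[of "N - X" F w] by auto
  then obtain g where g: "g \<in> F" "c \<notin> g" "crosses g ?R"
    using twoconnD[OF twoconn, of c w ?R x] cw x assms(1) by blast
  obtain r d where rd: "g = {r, d}" "r \<in> ?R" "d \<notin> ?R" "d \<in> N"
    using graph_edgeE[OF graph_root g(1)] g(3) by (metis crosses_pair insert_commute)
  have dX: "d \<in> X"
  proof (rule ccontr)
    assume "d \<notin> X"
    then have "d \<in> ?R" using reach_step[OF rd(2), of d] rd g(1) by simp
    then show False using rd by simp
  qed
  obtain us where us: "is_path (N - X) F us" "hd us = w" "last us = r"
    using rd(2) unfolding reach_def by blast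
  have "us \<noteq> []" "set us \<subseteq> N - X" "distinct us" "path_edges us \<subseteq> F" using us(1) by (auto simp: is_path_def)
  moreover have "c \<noteq> d" using g(2) rd(1) by blast
  moreover have "path_edges (c # us @ [d]) = insert f (insert g (path_edges us))"
    using \<open>us \<noteq> []\<close> us cw rd by (auto simp: path_edges_Cons path_edges_append)
  ultimately show ?thesis using that[of c d us] cw(2) dX f(1) g(1) by auto
qed

text \<open>The last clause is 2-edge-connectivity in cut form. Adding ears preserves it, it gives
  every vertex two edges, and it supplies a second edge across a cut when one is to be
  deleted.\<close>

definition bridgeless :: "'b set \<Rightarrow> 'b set set \<Rightarrow> bool" where
  "bridgeless X G \<longleftrightarrow> G \<subseteq> F \<and> X \<subseteq> N \<and> (\<forall>f\<in>G. f \<subseteq> X) \<and> (\<exists>x\<in>X. \<exists>y\<in>X. x \<noteq> y) \<and>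
    (\<forall>A. X \<inter> A \<noteq> {} \<and> \<not> X \<subseteq> A \<longrightarrow> (\<exists>f\<in>G. \<exists>g\<in>G. f \<noteq> g \<and> crosses f A \<and> crosses g A))"

definition star :: "'b set set \<Rightarrow> 'b \<Rightarrow> 'a set" where
  "star G x = \<phi> ` {f \<in> G. x \<in> f}"

lemma bridgeless_two:
  assumes "bridgeless X G" obtains x y where "x \<in> X" "y \<in> X" "x \<noteq> y"
proof -
  have "\<exists>x\<in>X. \<exists>y\<in>X. x \<noteq> y" using assms by (simp add: bridgeless_def)
  then show ?thesis using that by blast
qed

lemma bridgelessD:
  assumes "bridgeless X G" "u \<in> X" "u \<in> A" "w \<in> X" "w \<notin> A"
  obtains f g where "f \<in> G" "g \<in> G" "f \<noteq> g" "crosses f A" "crosses g A"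
proof -
  have "X \<inter> A \<noteq> {} \<and> \<not> X \<subseteq> A" using assms by blast
  then show ?thesis using assms(1) that unfolding bridgeless_def by metis
qed

lemma two_edges:
  assumes b: "bridgeless X G" and x: "x \<in> X"
  obtains a b where "{x, a} \<in> G" "{x, b} \<in> G" "a \<noteq> b" "a \<noteq> x" "b \<noteq> x"
proof -
  obtain y where "y \<in> X" "y \<noteq> x" using bridgeless_two[OF b] by metis
  then obtain f g where fg: "f \<in> G" "g \<in> G" "f \<noteq> g" "crosses f {x}" "crosses g {x}"
    using bridgelessD[OF b x, of "{x}" y] by blast
  then have "x \<in> f" "x \<in> g" "card f = 2" "card g = 2"
    using edge b by (auto simp: crosses_def bridgeless_def)
  then show ?thesis using that fg by (metis card2E)
qed

text \<open>If \<open>x\<close> were missing from \<open>k\<close>, then \<open>k\<close> would join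
  the other ends of \<open>f\<close> and \<open>g\<close> and close a triangle.\<close>

lemma line_triangle:
  assumes "f \<in> F" "g \<in> F" "k \<in> F" "x \<in> f" "x \<in> g" "f \<noteq> g" "f \<inter> k \<noteq> {}" "g \<inter> k \<noteq> {}"
  shows "x \<in> k"
proof (rule ccontr)
  assume "x \<notin> k"
  obtain a b where ab: "f = {x, a}" "g = {x, b}" using assms edge by (metis card2E)
  then have "a \<in> k" "b \<in> k" "a \<noteq> b" using assms \<open>x \<notin> k\<close> by auto
  then have "k = {a, b}" using edge[OF assms(3)] by (metis card2E insertE singletonD)
  then show False using triangle_free[of a x b] ab assms by (simp add: insert_commute)
qed

lemma star_complete: "G \<subseteq> F \<Longrightarrow> complete_set (line_edges G) (star G x)"
  unfolding complete_set_def star_def using line_edges_pair[of G] by auto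

text \<open>Maximality rests on the two edges at \<open>x\<close>: an edge meeting both without
  containing \<open>x\<close> would close a triangle.\<close>

lemma star_clique:
  assumes b: "bridgeless X G" and x: "x \<in> X"
  shows "is_clique (\<phi> ` G) (line_edges G) (star G x)"
proof -
  have G: "G \<subseteq> F" using b by (simp add: bridgeless_def)
  have "\<not> complete_set (line_edges G) D" if D: "star G x \<subset> D" "D \<subseteq> \<phi> ` G" for D
  proof
    assume c: "complete_set (line_edges G) D"
    obtain y where y: "y \<in> D" "y \<notin> star G x" using D(1) by blast
    then obtain k where "k \<in> G" "y = \<phi> k" using D(2) by blast
    then have k: "k \<in> G" "\<phi> k \<in> D" "x \<notin> k" using y by (auto simp: star_def)
    obtain a b where ab: "{x, a} \<in> G" "{x, b} \<in> G" "a \<noteq> b" using two_edges[OF b x] .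
    have "f \<inter> k \<noteq> {}" if f: "f \<in> G" "x \<in> f" for f
    proof -
      have "f \<noteq> k" using k f by blast
      then have "\<phi> f \<noteq> \<phi> k" using inj G k f by (meson inj_onD subsetD)
      moreover have "\<phi> f \<in> D" using D f unfolding star_def by blast
      ultimately have "{\<phi> f, \<phi> k} \<in> line_edges G" using complete_set_adj[OF c] k by blast
      then show ?thesis using line_edges_pair[OF G f(1) k(1) \<open>f \<noteq> k\<close>] by simp
    qed
    then have "x \<in> k"
      using line_triangle[of "{x, a}" "{x, b}" k x] ab k G by (auto simp: doubleton_eq_iff)
    then show False using k by simp
  qed
  moreover have "star G x \<subseteq> \<phi> ` G" by (auto simp: star_def)
  ultimately show ?thesis unfolding is_clique_def using star_complete[OF G] by blast
qed

text \<open>By absence of triangles every clique lies in a star and hence equals it. Two edges at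
  \<open>x\<close> with distinct other ends cannot both contain a second vertex \<open>y\<close>, so
  different vertices have different stars.\<close>

lemma card_cliques:
  assumes b: "bridgeless X G"
  shows "card (cliques (\<phi> ` G) (line_edges G)) = card X"
proof -
  have G: "G \<subseteq> F" and GX: "\<And>f. f \<in> G \<Longrightarrow> f \<subseteq> X" using b by (simp_all add: bridgeless_def)
  have phi_eq: "f = g" if "\<phi> f = \<phi> g" "f \<in> G" "g \<in> G" for f g
    using inj G that by (meson inj_onD subsetD)
  obtain x0 where "x0 \<in> X" using bridgeless_two[OF b] .
  then have Gne: "\<phi> ` G \<noteq> {}" using two_edges[OF b] by blast
  have "cliques (\<phi> ` G) (line_edges G) = star G ` X"
  proof (intro equalityI subsetI)
    fix K assume "K \<in> cliques (\<phi> ` G) (line_edges G)"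
    then have K: "is_clique (\<phi> ` G) (line_edges G) K" by (simp add: cliques_def)
    then have Kc: "complete_set (line_edges G) K" "K \<subseteq> \<phi> ` G" by (auto simp: is_clique_def)
    have meet: "f \<inter> g \<noteq> {}" if "\<phi> f \<in> K" "\<phi> g \<in> K" "f \<in> G" "g \<in> G" for f g
    proof (cases "f = g")
      case True
      then show ?thesis using edge[of f] that G by auto
    next
      case False
      then have "\<phi> f \<noteq> \<phi> g" using phi_eq that by blast
      then show ?thesis
        using complete_set_adj[OF Kc(1)] that line_edges_pair[OF G that(3,4) False] by simp
    qed
    obtain f where f: "f \<in> G" "\<phi> f \<in> K" using clique_nonempty[OF K Gne] Kc(2) by blast
    have "\<exists>x\<in>X. K \<subseteq> star G x"
    proof (cases "K = {\<phi> f}")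
      case True
      obtain x where "x \<in> f" using meet[OF f(2,2,1,1)] by blast
      then show ?thesis using True f GX by (auto simp: star_def)
    next
      case False
      then obtain g where g: "g \<in> G" "\<phi> g \<in> K" "f \<noteq> g" using f Kc(2) by blast
      then obtain x where x: "x \<in> f" "x \<in> g" using meet f by blast
      have "x \<in> k" if k: "k \<in> G" "\<phi> k \<in> K" for k
        using line_triangle[of f g k x] x g f k meet G by (metis subsetD)
      then have "K \<subseteq> star G x" using Kc(2) unfolding star_def by blast
      then show ?thesis using x f GX by blast
    qed
    then obtain x where x: "x \<in> X" "K \<subseteq> star G x" by blast
    have "star G x \<subseteq> \<phi> ` G" by (auto simp: star_def)
    then have "K = star G x" using K x(2) star_complete[OF G, of x] unfolding is_clique_def by blast
    then show "K \<in> star G ` X" using x by blast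
  next
    fix K assume "K \<in> star G ` X"
    then show "K \<in> cliques (\<phi> ` G) (line_edges G)" using star_clique[OF b] by (auto simp: cliques_def)
  qed
  moreover have "inj_on (star G) X"
  proof (rule inj_onI, rule ccontr)
    fix x y assume xy: "x \<in> X" "y \<in> X" "star G x = star G y" "x \<noteq> y"
    obtain a b where ab: "{x, a} \<in> G" "{x, b} \<in> G" "a \<noteq> b" using two_edges[OF b xy(1)] .
    have "y \<in> f" if f: "f \<in> G" "x \<in> f" for f
    proof -
      have "\<phi> f \<in> star G y" using f xy(3) unfolding star_def by blast
      then obtain f' where "\<phi> f = \<phi> f'" "f' \<in> G" "y \<in> f'" unfolding star_def by blast
      then show ?thesis using phi_eq f by blast
    qed
    then have "y = a" "y = b" using ab xy(4) by auto
    then show False using ab by simp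
  qed
  ultimately show ?thesis by (simp add: card_image)
qed

text \<open>The right-hand side is the edge set that \<open>gate.extend\<close> produces from the
  path of ear edges and the stars of \<open>c\<close> and \<open>d\<close>. The pairs of meeting
  edges are sorted into old with old, old with ear, and ear with ear.\<close>

lemma ear_line_edges:
  assumes G: "G \<subseteq> F" "\<And>f. f \<in> G \<Longrightarrow> f \<subseteq> X"
    and ear: "us \<noteq> []" "set us \<inter> X = {}" "distinct (c # us @ [d])" "path_edges (c # us @ [d]) \<subseteq> F"
  defines "ps \<equiv> map \<phi> (edge_list (c # us @ [d]))"
  shows "line_edges (G \<union> path_edges (c # us @ [d])) =
    line_edges G \<union> path_edges ps \<union> {{hd ps, p} | p. p \<in> star G c} \<union> {{last ps, p} | p. p \<in> star G d}"
    (is "?L = ?R")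
proof -
  let ?ws = "c # us @ [d]"
  let ?es = "edge_list ?ws"
  let ?n = "length us + 1"
  have len: "length ?es = ?n" "?n \<ge> 2" using ear(1) by (auto simp: Suc_le_eq)
  have es: "?es ! i \<in> path_edges ?ws" if "i < ?n" for i
    using that len set_edge_list[of ?ws] nth_mem[of i ?es] by simp
  have nth: "ps ! i = \<phi> (?es ! i)" if "i < ?n" for i using that len by (simp add: ps_def)
  have lps: "length ps = ?n" using len by (simp add: ps_def)
  have hd: "hd ps = \<phi> (?es ! 0)" using nth[of 0] lps by (cases ps) auto
  have last: "last ps = \<phi> (?es ! length us)" using nth[of "length us"] lps
    by (subst last_conv_nth) auto
  have notG: "?es ! i \<notin> G" if "i < ?n" for i using ear_leaves[OF ear(1,2) es[OF that]] G(2) by blast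
  have GF: "G \<union> path_edges ?ws \<subseteq> F" using G ear by simp
  note meet = edge_list_meet[OF ear(3), simplified]
  note base = edge_list_meet_base[OF ear(3,1,2)]
  have pe: "path_edges ps = {{\<phi> (?es ! i), \<phi> (?es ! Suc i)} | i. Suc i < ?n}"
    unfolding path_edges_def lps using nth by (metis (no_types, opaque_lifting) Suc_lessD)
  have neq: "?es ! i \<noteq> ?es ! j" if "i < ?n" "j < ?n" "i \<noteq> j" for i j
    using distinct_edge_list[OF ear(3)] that len by (simp add: nth_eq_iff_index_eq)
  have idx: "\<exists>i < ?n. f = ?es ! i" if "f \<in> path_edges ?ws" for f
    using that len unfolding set_edge_list[symmetric] in_set_conv_nth by metis
  have mixed: "{\<phi> (?es ! i), \<phi> f} \<in> ?R" if "i < ?n" "f \<in> G" "?es ! i \<inter> f \<noteq> {}" for i f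
  proof -
    have "i = 0 \<and> c \<in> f \<or> i = length us \<and> d \<in> f" using base[OF G(2)[OF that(2)] that(1)] that(3) by simp
    then have "i = 0 \<and> \<phi> f \<in> star G c \<or> i = length us \<and> \<phi> f \<in> star G d"
      using that(2) unfolding star_def by blast
    then show ?thesis using hd last by auto
  qed
  have "e \<in> ?R" if eL: "e \<in> ?L" for e
  proof -
    obtain f g where fg: "f \<in> G \<union> path_edges ?ws" "g \<in> G \<union> path_edges ?ws" "f \<noteq> g" "f \<inter> g \<noteq> {}"
      "e = {\<phi> f, \<phi> g}" using eL unfolding line_edges_iff[OF GF] by blast
    consider "f \<in> G" "g \<in> G" | i where "f \<in> G" "i < ?n" "g = ?es ! i"
      | i where "g \<in> G" "i < ?n" "f = ?es ! i"
      | i j where "i < ?n" "j < ?n" "f = ?es ! i" "g = ?es ! j"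
      using fg(1,2) idx by (metis UnE)
    then show ?thesis
    proof cases
      case 1
      then show ?thesis using fg line_edges_iff[OF G(1)] by blast
    next
      case 2
      then have "{\<phi> g, \<phi> f} \<in> ?R" using mixed fg(4) by (simp add: Int_commute)
      then show ?thesis using fg(5) by (simp add: insert_commute)
    next
      case 3
      then show ?thesis using mixed fg(4,5) by simp
    next
      case (4 i j)
      then have "i = Suc j \<or> j = Suc i" using meet[of i j] fg(3,4) by auto
      then have "e \<in> path_edges ps" unfolding pe using 4 fg(5) by (auto simp: insert_commute)
      then show ?thesis by blast
    qed
  qed
  moreover have "e \<in> ?L" if eR: "e \<in> ?R" for e
  proof -
    consider "e \<in> line_edges G" | "e \<in> path_edges ps"
      | f where "f \<in> G" "c \<in> f" "e = {hd ps, \<phi> f}" | f where "f \<in> G" "d \<in> f" "e = {last ps, \<phi> f}"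
      using eR unfolding star_def by blast
    then show ?thesis
    proof cases
      case 1
      then show ?thesis using line_edges_iff[OF G(1)] line_edges_iff[OF GF] by (metis UnI1)
    next
      case 2
      then obtain i where i: "Suc i < ?n" "e = {\<phi> (?es ! i), \<phi> (?es ! Suc i)}" unfolding pe by blast
      have "?es ! i \<inter> ?es ! Suc i \<noteq> {}" using meet[of i "Suc i"] i by simp
      moreover have "?es ! i \<noteq> ?es ! Suc i" using neq[of i "Suc i"] i by simp
      ultimately show ?thesis unfolding line_edges_iff[OF GF] using es[of i] es[of "Suc i"] i
        by (metis Suc_lessD UnI2)
    next
      case (3 f)
      have "?es ! 0 \<inter> f \<noteq> {}" using base[OF G(2)[OF 3(1)], of 0] 3 by simp
      then show ?thesis unfolding line_edges_iff[OF GF] using es[of 0] notG[of 0] 3 hd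
        by (metis UnI1 UnI2 add_gr_0 zero_less_one)
    next
      case (4 f)
      have "?es ! length us \<inter> f \<noteq> {}" using base[OF G(2)[OF 4(1)], of "length us"] 4 by simp
      then show ?thesis unfolding line_edges_iff[OF GF] using es[of "length us"] notG[of "length us"] 4 last
        by (metis UnI1 UnI2 less_add_one)
    qed
  qed
  ultimately show ?thesis by blast
qed

text \<open>A cut that does not divide \<open>X\<close> separates an inner vertex from both ends, so
  the ear alone crosses it twice. Cuts dividing \<open>X\<close> are left to \<open>old\<close>,
  which may count ear edges as well; this allows a start from a single edge.\<close>

lemma bridgeless_ear:
  assumes X: "G \<subseteq> F" "X \<subseteq> N" "\<And>f. f \<in> G \<Longrightarrow> f \<subseteq> X" "c \<in> X" "d \<in> X"
    and ear: "us \<noteq> []" "set us \<subseteq> N - X" "distinct (c # us @ [d])" "path_edges (c # us @ [d]) \<subseteq> F"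
    and old: "\<And>A. X \<inter> A \<noteq> {} \<Longrightarrow> \<not> X \<subseteq> A \<Longrightarrow> \<exists>f\<in>G \<union> path_edges (c # us @ [d]).
      \<exists>g\<in>G \<union> path_edges (c # us @ [d]). f \<noteq> g \<and> crosses f A \<and> crosses g A"
  shows "bridgeless (X \<union> set us) (G \<union> path_edges (c # us @ [d]))"
  unfolding bridgeless_def
proof (intro conjI allI impI ballI)
  let ?H = "G \<union> path_edges (c # us @ [d])"
  show "?H \<subseteq> F" using X ear by blast
  show "X \<union> set us \<subseteq> N" using X ear by blast
  show "\<exists>x\<in>X \<union> set us. \<exists>y\<in>X \<union> set us. x \<noteq> y" using X(4,5) ear(3) by auto
  show "f \<subseteq> X \<union> set us" if "f \<in> ?H" for f
    using that X(3)[of f] path_edges_subset[of f "c # us @ [d]"] X(4,5) by auto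
  fix A assume A: "(X \<union> set us) \<inter> A \<noteq> {} \<and> \<not> X \<union> set us \<subseteq> A"
  show "\<exists>f\<in>?H. \<exists>g\<in>?H. f \<noteq> g \<and> crosses f A \<and> crosses g A"
  proof (cases "X \<inter> A \<noteq> {} \<and> \<not> X \<subseteq> A")
    case True
    then show ?thesis using old by blast
  next
    case False
    then have cd: "(x \<in> A) = (c \<in> A)" if "x \<in> X" for x using that X(4) by blast
    have "\<exists>u\<in>set us. (u \<in> A) \<noteq> (c \<in> A)"
    proof (rule ccontr)
      assume "\<not> ?thesis"
      then have "(x \<in> A) = (c \<in> A)" if "x \<in> X \<union> set us" for x using cd that by blast
      then show False using A by blast
    qed
    then obtain u where "u \<in> set us" "(u \<in> A) \<noteq> (c \<in> A)" by blast
    then have "\<exists>f \<in> path_edges (c # us @ [d]). \<exists>g \<in> path_edges (c # us @ [d]).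
      f \<noteq> g \<and> crosses f A \<and> crosses g A"
      using ear_crosses_twice[OF ear(3), of A u] cd[OF X(5)] by simp
    then show ?thesis by blast
  qed
qed

text \<open>An ear parallel to an edge of \<open>G\<close> would make that edge redundant for 2-connectivity.\<close>
lemma ear_ends_nonadjacent:
  assumes b: "bridgeless X G"
    and ear: "us \<noteq> []" "set us \<subseteq> N - X" "distinct (c # us @ [d])" "path_edges (c # us @ [d]) \<subseteq> F"
    and cd: "c \<in> X" "d \<in> X"
  shows "{c, d} \<notin> G"
proof
  assume "{c, d} \<in> G"
  have G: "G \<subseteq> F" and GX: "\<And>f. f \<in> G \<Longrightarrow> f \<subseteq> X" using b by (simp_all add: bridgeless_def)
  let ?e = "{c, d}" and ?ws = "c # us @ [d]"
  have "twoconn N (F - {?e})"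
    unfolding twoconn_def
  proof (intro ballI allI impI)
    fix a A assume a: "a \<in> N" and A: "(N - {a}) \<inter> A \<noteq> {} \<and> \<not> N - {a} \<subseteq> A"
    then obtain f where f: "f \<in> F" "a \<notin> f" "crosses f A"
      using twoconn unfolding twoconn_def by metis
    show "\<exists>f\<in>F - {?e}. a \<notin> f \<and> crosses f A"
    proof (cases "f = ?e")
      case False
      then show ?thesis using f by blast
    next
      case True
      then have cda: "a \<noteq> c" "a \<noteq> d" "(c \<in> A) \<noteq> (d \<in> A)" using f by (auto simp: crosses_pair)
      show ?thesis
      \<comment> \<open>If \<open>a\<close> is off the ear, the ear is a detour for the deleted
        edge. If \<open>a\<close> is on the ear, it lies outside \<open>X\<close>, and
        \<open>G\<close> has a second edge across the cut.\<close>
      proof (cases "a \<in> set us")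
        case False
        have "set ?ws \<inter> A \<noteq> {}" "\<not> set ?ws \<subseteq> A" using cda(3) by auto
        then obtain g where g: "g \<in> path_edges ?ws" "crosses g A" using path_crosses by metis
        have "a \<notin> g" using path_edges_subset[OF g(1)] cda False by auto
        moreover have "\<not> g \<subseteq> X" using ear_leaves[OF ear(1) _ g(1)] ear(2) by blast
        then have "g \<noteq> ?e" using cd by blast
        ultimately show ?thesis using g ear(4) by blast
      next
        case True
        then have aX: "a \<notin> X" using ear by blast
        obtain g k where gk: "g \<in> G" "k \<in> G" "g \<noteq> k" "crosses g A" "crosses k A"
        proof (cases "c \<in> A")
          case True
          then show ?thesis using bridgelessD[OF b cd(1), of A d] cda(3) cd(2) that by blast
        next
          case False
          then show ?thesis using bridgelessD[OF b cd(2), of A c] cda(3) cd(1) that by blast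
        qed
        then obtain l where l: "l \<in> G" "l \<noteq> ?e" "crosses l A" by metis
        then have "a \<notin> l" using GX aX by blast
        then show ?thesis using l G by blast
      qed
    qed
  qed
  then show False using minimal \<open>{c, d} \<in> G\<close> G by blast
qed

section \<open>Building the gate ear by ear\<close>

definition good :: "'b set \<Rightarrow> 'b set set \<Rightarrow> bool" where
  "good X G \<longleftrightarrow> bridgeless X G \<and> gate (\<phi> ` G) (line_edges G)"

lemma distinct_ear_map:
  assumes "distinct ws" "path_edges ws \<subseteq> F"
  shows "distinct (map \<phi> (edge_list ws))"
  using distinct_edge_list[OF assms(1)] inj_on_subset[OF inj assms(2)]
  by (simp add: distinct_map set_edge_list)

text \<open>A single edge and an ear attached to both of its ends form a cycle, whose line graph is
  a cycle of the same length.\<close>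

lemma good_start: "\<exists>X G. good X G"
proof -
  obtain x where "x \<in> N" using card_N by fastforce
  moreover have "\<not> N \<subseteq> {x}" using card_N card_mono[of "{x}" N] by force
  then obtain y where "y \<in> N" "y \<noteq> x" by blast
  ultimately obtain f where f: "f \<in> F" using connected[of x "{x}" y] by blast
  obtain u w where uw: "f = {u, w}" "u \<noteq> w" "u \<in> N" "w \<in> N" using graph_edgeE[OF graph_root f] .
  have "{u, w} \<noteq> N" using card_N uw(2) by auto
  then obtain c us d where ear: "c \<in> {u, w}" "d \<in> {u, w}" "us \<noteq> []" "set us \<subseteq> N - {u, w}"
    "distinct (c # us @ [d])" "path_edges (c # us @ [d]) \<subseteq> F"
    using ear_exists[of "{u, w}" u w] uw by (metis empty_subsetI insertCI insert_subset)
  let ?ws = "c # us @ [d]"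
  have fcd: "f = {c, d}" using ear(1,2,5) uw by auto
  let ?X = "{c, d}"
  have us: "set us \<inter> ?X = {}" using ear(5) by auto
  have "bridgeless (?X \<union> set us) ({f} \<union> path_edges ?ws)"
  proof (rule bridgeless_ear)
    show "set us \<subseteq> N - ?X" using ear(4) us by blast
    fix A assume "?X \<inter> A \<noteq> {}" "\<not> ?X \<subseteq> A"
    then have cd: "(c \<in> A) \<noteq> (d \<in> A)" by blast
    then have "set ?ws \<inter> A \<noteq> {}" "\<not> set ?ws \<subseteq> A" by auto
    then obtain g where g: "g \<in> path_edges ?ws" "crosses g A" using path_crosses by metis
    have "g \<noteq> f" using ear_leaves[OF ear(3) us g(1)] fcd by blast
    moreover have "crosses f A" using cd fcd by (simp add: crosses_pair)
    ultimately show "\<exists>f'\<in>{f} \<union> path_edges ?ws. \<exists>g\<in>{f} \<union> path_edges ?ws.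
      f' \<noteq> g \<and> crosses f' A \<and> crosses g A" using g by blast
  qed (use ear uw f fcd in auto)
  moreover have "gate (\<phi> ` ({f} \<union> path_edges ?ws)) (line_edges ({f} \<union> path_edges ?ws))"
  proof -
    define ps where "ps = map \<phi> (edge_list ?ws)"
    \<comment> \<open>One inner vertex would give a triangle with \<open>f\<close>. Two of them give
      three ear edges, which together with \<open>f\<close> make the length 4 that
      \<open>gate.cycle\<close> asks for.\<close>
    have len: "length us \<ge> 2"
    proof (rule ccontr)
      assume "\<not> ?thesis"
      then obtain v where "us = [v]" using ear(3) by (cases us; cases "tl us") auto
      then show False using ear(6) f fcd triangle_free[of c v d] by simp
    qed
    then have lps: "length ps \<ge> 3" by (simp add: ps_def)
    have le0: "line_edges ({f} \<union> path_edges ?ws) = line_edges {f} \<union> path_edges ps \<union>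
        {{hd ps, p} | p. p \<in> star {f} c} \<union> {{last ps, p} | p. p \<in> star {f} d}"
      unfolding ps_def using ear_line_edges[OF _ _ ear(3) us ear(5,6), of "{f}"] f fcd by simp
    have le1: "line_edges {f} = {}" using line_edges_iff[of "{f}"] f by auto
    have st: "star {f} c = {\<phi> f}" "star {f} d = {\<phi> f}" using fcd by (auto simp: star_def)
    have "ps \<noteq> []" using lps by auto
    have le: "line_edges ({f} \<union> path_edges ?ws) = cycle_edges (\<phi> f # ps)"
      unfolding le0 le1 st cycle_edges_Cons[OF \<open>ps \<noteq> []\<close>] by (auto simp: insert_commute)
    have sps: "set ps = \<phi> ` path_edges ?ws" by (simp add: ps_def set_edge_list)
    have "f \<notin> path_edges ?ws" using ear_leaves[OF ear(3) us] fcd by blast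
    then have "\<phi> f \<notin> set ps" using inj f ear(6) unfolding sps by (meson inj_on_image_mem_iff)
    then have "distinct (\<phi> f # ps)" using distinct_ear_map[OF ear(5,6)] by (simp add: ps_def)
    then have "gate (set (\<phi> f # ps)) (cycle_edges (\<phi> f # ps))"
      using lps by (intro gate.cycle) auto
    then show ?thesis using le sps by simp
  qed
  ultimately show ?thesis unfolding good_def by blast
qed

lemma good_step:
  assumes g: "good X G" and "X \<noteq> N"
  shows "\<exists>X' G'. good X' G' \<and> X \<subset> X'"
proof -
  have b: "bridgeless X G" and gate: "gate (\<phi> ` G) (line_edges G)" using g by (auto simp: good_def)
  have G: "G \<subseteq> F" "X \<subseteq> N" and GX: "\<And>f. f \<in> G \<Longrightarrow> f \<subseteq> X" using b by (simp_all add: bridgeless_def)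
  obtain x y where "x \<in> X" "y \<in> X" "x \<noteq> y" using bridgeless_two[OF b] .
  then obtain c us d where ear: "c \<in> X" "d \<in> X" "us \<noteq> []" "set us \<subseteq> N - X"
    "distinct (c # us @ [d])" "path_edges (c # us @ [d]) \<subseteq> F"
    using ear_exists[OF G(2) assms(2)] by metis
  let ?ws = "c # us @ [d]"
  let ?G = "G \<union> path_edges ?ws"
  have us: "set us \<inter> X = {}" using ear by blast
  have "bridgeless (X \<union> set us) ?G"
  proof (rule bridgeless_ear[OF G GX ear])
    fix A assume "X \<inter> A \<noteq> {}" "\<not> X \<subseteq> A"
    then have "\<exists>f\<in>G. \<exists>g\<in>G. f \<noteq> g \<and> crosses f A \<and> crosses g A"
      using b unfolding bridgeless_def by simp
    then show "\<exists>f\<in>?G. \<exists>g\<in>?G. f \<noteq> g \<and> crosses f A \<and> crosses g A" by blast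
  qed
  moreover have "gate (\<phi> ` ?G) (line_edges ?G)"
  proof -
    define ps where "ps = map \<phi> (edge_list ?ws)"
    have le: "line_edges ?G = line_edges G \<union> path_edges ps \<union>
        {{hd ps, p} | p. p \<in> star G c} \<union> {{last ps, p} | p. p \<in> star G d}"
      unfolding ps_def by (rule ear_line_edges[OF G(1) GX ear(3) us ear(5,6)])
    have sps: "set ps = \<phi> ` path_edges ?ws" by (simp add: ps_def set_edge_list)
    have "G \<inter> path_edges ?ws = {}" using ear_leaves[OF ear(3) us] GX by blast
    then have "\<phi> ` (G \<inter> path_edges ?ws) = {}" by simp
    then have dj: "set ps \<inter> \<phi> ` G = {}" unfolding sps
      using inj_on_image_Int[OF inj G(1) ear(6)] by (simp add: Int_commute)
    \<comment> \<open>A common member would come from the edge \<open>{c, d}\<close>, which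
      minimality excludes.\<close>
    have "star G c \<inter> star G d = {}"
    proof (rule ccontr)
      assume "star G c \<inter> star G d \<noteq> {}"
      then obtain f f' where f: "f \<in> G" "c \<in> f" "f' \<in> G" "d \<in> f'" "\<phi> f = \<phi> f'"
        unfolding star_def by auto
      then have "f = f'" using inj G(1) by (meson inj_onD subsetD)
      moreover have "c \<noteq> d" using ear(5) by simp
      ultimately have "f = {c, d}" using f edge[of f] G(1) by (metis card2E insertE singletonD subsetD)
      then show False using ear_ends_nonadjacent[OF b ear(3-6,1,2)] f by simp
    qed
    moreover have "length ps \<ge> 2" using ear(3) by (cases us) (auto simp: ps_def)
    ultimately have "gate (\<phi> ` G \<union> set ps) (line_edges ?G)"
      unfolding le using gate star_clique[OF b ear(1)] star_clique[OF b ear(2)] dj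
        distinct_ear_map[OF ear(5,6)] by (intro gate.extend) (auto simp: ps_def)
    then show ?thesis by (simp add: sps image_Un)
  qed
  moreover have "X \<subset> X \<union> set us" using ear(3) us by (cases us) auto
  ultimately show ?thesis unfolding good_def by blast
qed

text \<open>Ears are added until \<open>X\<close> is all of \<open>N\<close>. The graph
  \<open>G\<close> then reached may still omit edges of \<open>F\<close>, so the gate is induced on
  the image of \<open>G\<close>; being spanning, \<open>G\<close> has one star for each vertex of
  \<open>N\<close>.\<close>

lemma line_graph_gate:
  obtains S where "S \<subseteq> \<phi> ` F" "k_gate S (induced_edges E S) (card N)"
proof -
  obtain X0 G0 where "good X0 G0" using good_start by blast
  moreover have "\<exists>G. good N G" if "good X G" for X G
    using that
  proof (induction "card (N - X)" arbitrary: X G rule: less_induct)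
    case less
    show ?case
    proof (cases "X = N")
      case True
      then show ?thesis using less.prems by blast
    next
      case False
      then obtain X' G' where X': "good X' G'" "X \<subset> X'" using good_step[OF less.prems] by blast
      then have "X' \<subseteq> N" by (simp add: good_def bridgeless_def)
      then have "N - X' \<subset> N - X" using X'(2) by blast
      then have "card (N - X') < card (N - X)" using finite_N by (simp add: psubset_card_mono)
      then show ?thesis using less.hyps X'(1) by blast
    qed
  qed
  ultimately obtain G where G: "bridgeless N G" "gate (\<phi> ` G) (line_edges G)"
    unfolding good_def by blast
  have "k_gate (\<phi> ` G) (line_edges G) (card N)"
    unfolding k_gate_def using G card_cliques by blast
  moreover have "\<phi> ` G \<subseteq> \<phi> ` F" using G(1) by (auto simp: bridgeless_def)
  ultimately show ?thesis using that[of "\<phi> ` G"] by (simp add: line_edges_def)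
qed

end

text \<open>By finiteness there is an inclusion-minimal 2-connected \<open>F'\<close> within
  \<open>F\<close>; absence of triangles, injectivity and the adjacency rule pass to it.\<close>

theorem line_graph_has_gate:
  fixes N :: "'b set" and \<phi> :: "'b set \<Rightarrow> 'a"
  assumes "graph N F" "card N \<ge> 4" "twoconn N F"
    and tf: "\<And>x y z. {x, y} \<in> F \<Longrightarrow> {y, z} \<in> F \<Longrightarrow> {x, z} \<in> F \<Longrightarrow> False"
    and inj: "inj_on \<phi> F"
    and adj: "\<And>f g. f \<in> F \<Longrightarrow> g \<in> F \<Longrightarrow> f \<noteq> g \<Longrightarrow> {\<phi> f, \<phi> g} \<in> E \<longleftrightarrow> f \<inter> g \<noteq> {}"
    and E: "\<And>e. e \<in> E \<Longrightarrow> card e = 2"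
  obtains S where "S \<subseteq> \<phi> ` F" "k_gate S (induced_edges E S) (card N)"
proof -
  let ?\<C> = "{F'. F' \<subseteq> F \<and> twoconn N F'}"
  have "finite ?\<C>" using graph_finite_edges[OF assms(1)] by simp
  moreover have "F \<in> ?\<C>" using assms by blast
  ultimately have "\<exists>m\<in>?\<C>. \<forall>H\<in>?\<C>. H \<subseteq> m \<longrightarrow> m = H" by (intro finite_has_minimal) auto
  then obtain F' where F': "F' \<in> ?\<C>" and "\<forall>H\<in>?\<C>. H \<subseteq> F' \<longrightarrow> F' = H" by (rule bexE)
  then have min: "F' = H" if "H \<subseteq> F" "twoconn N H" "H \<subseteq> F'" for H using that by simp
  interpret root_graph N F' \<phi> E
  proof
    show "graph N F'" using assms(1) F' by (auto simp: graph_def)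
    show "card N \<ge> 4" "twoconn N F'" using assms F' by auto
    show "\<not> twoconn N (F' - {e})" if "e \<in> F'" for e
      using min[of "F' - {e}"] F' that by blast
    show False if "{x, y} \<in> F'" "{y, z} \<in> F'" "{x, z} \<in> F'" for x y z
      using tf[of x y z] that F' by blast
    show "inj_on \<phi> F'" using inj F' by (simp add: inj_on_subset)
    show "{\<phi> f, \<phi> g} \<in> E \<longleftrightarrow> f \<inter> g \<noteq> {}" if "f \<in> F'" "g \<in> F'" "f \<noteq> g" for f g
      using adj[of f g] that F' by blast
  qed (rule E)
  obtain S where S: "S \<subseteq> \<phi> ` F'" "k_gate S (induced_edges E S) (card N)" using line_graph_gate .
  have "S \<subseteq> \<phi> ` F" using S(1) F' by blast
  then show ?thesis using S(2) by (rule that)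
qed

subsection \<open>Splitting a vertex of the host tree\<close>

lemma tree_subpath_mono:
  assumes "tree_subpath V E ps" "V \<subseteq> V'" "E \<subseteq> E'" shows "tree_subpath V' E' ps"
  using assms unfolding tree_subpath_def is_path_def by blast

text \<open>Natural subtraction counts degrees up to 3 as zero, so the degree-3 vertex created by a
  split costs nothing.\<close>

definition excess :: "'b set \<Rightarrow> 'b set set \<Rightarrow> nat" where
  "excess VT ET = (\<Sum>x\<in>VT. degree ET x - 3)"

text \<open>The vertex \<open>q\<close> keeps its neighbours in \<open>A\<close>, its copy \<open>q'\<close> takes those in \<open>B\<close>, and the
  edge towards \<open>a\<close> is subdivided by \<open>z\<close>, to which \<open>q\<close> and \<open>q'\<close> are attached.\<close>
locale split_tree = tree VT ET for VT :: "'b set" and ET :: "'b set set" +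
  fixes q a :: 'b and A B :: "'b set" and q' z :: 'b
  assumes q: "q \<in> VT"
    and nbrs: "{x. {q, x} \<in> ET} = insert a (A \<union> B)"
    and disj: "a \<notin> A" "a \<notin> B" "A \<inter> B = {}"
    and fresh: "q' \<notin> VT" "z \<notin> VT" "q' \<noteq> z"
begin

definition VS :: "'b set" where
  "VS = insert q' (insert z VT)"

definition ES :: "'b set set" where
  "ES = {e \<in> ET. q \<notin> e} \<union> (\<lambda>x. {q, x}) ` A \<union> (\<lambda>x. {q', x}) ` B \<union> {{z, a}, {z, q}, {z, q'}}"

text \<open>Collapsing \<open>z\<close> and \<open>q'\<close> into \<open>q\<close> gives back the
  original tree; cuts and path edges are compared along this map.\<close>

definition contract :: "'b \<Rightarrow> 'b" where
  "contract v = (if v = q' \<or> v = z then q else v)"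

lemma nbr: "x = a \<or> x \<in> A \<or> x \<in> B \<longleftrightarrow> {q, x} \<in> ET"
  using nbrs by blast

lemma nbrD:
  assumes "x = a \<or> x \<in> A \<or> x \<in> B"
  shows "x \<in> VT" "x \<noteq> q" "x \<noteq> q'" "x \<noteq> z"
proof -
  have "{q, x} \<in> ET" using assms nbr by blast
  then show "x \<in> VT" "x \<noteq> q" using graph_edgeD[OF graph] by blast+
  then show "x \<noteq> q'" "x \<noteq> z" using fresh by blast+
qed

lemma q_neq: "q \<noteq> q'" "q \<noteq> z" "q' \<noteq> q" "z \<noteq> q" "z \<noteq> q'" "q' \<noteq> z"
  using q fresh by auto

lemma ES_cases [consumes 1, case_names old A B a q q']:
  assumes "e \<in> ES"
  obtains "e \<in> ET" "q \<notin> e" "q' \<notin> e" "z \<notin> e" | x where "x \<in> A" "e = {q, x}" | x where "x \<in> B" "e = {q', x}"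
    | "e = {z, a}" | "e = {z, q}" | "e = {z, q'}"
proof -
  have "q' \<notin> e \<and> z \<notin> e" if "e \<in> ET"
    using that graph fresh unfolding graph_def by blast
  then show ?thesis using assms that unfolding ES_def by blast
qed

lemma contract_id: "v \<in> VT \<Longrightarrow> contract v = v"
  using fresh by (auto simp: contract_def)

lemma contract_simps [simp]: "contract q = q" "contract q' = q" "contract z = q"
  by (auto simp: contract_def)

lemma contract_old: "q' \<notin> e \<Longrightarrow> z \<notin> e \<Longrightarrow> contract ` e = e"
  by (auto simp: contract_def image_iff)

lemma contract_nbr: "x = a \<or> x \<in> A \<or> x \<in> B \<Longrightarrow> contract x = x"
  using nbrD contract_id by blast

text \<open>A one-sided inverse of contraction on tree edges: an edge at \<open>q\<close> is
  reattached to \<open>q\<close>, \<open>q'\<close> or \<open>z\<close> according to whether its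
  other end lies in \<open>A\<close>, lies in \<open>B\<close>, or is \<open>a\<close>.\<close>

definition lift :: "'b set \<Rightarrow> 'b set" where
  "lift e = (if q \<notin> e then e else insert (if e - {q} \<subseteq> A then q else if e - {q} \<subseteq> B then q' else z) (e - {q}))"

lemma contract_ES:
  assumes "f \<in> ES"
  shows "contract ` f \<in> ET \<and> lift (contract ` f) = f \<or> (f = {z, q} \<or> f = {z, q'}) \<and> contract ` f = {q}"
  using assms
proof (cases rule: ES_cases)
  case old
  then show ?thesis by (simp add: contract_old lift_def)
next
  case (A x)
  then have "{q, x} - {q} = {x}" using nbrD[of x] by auto
  then show ?thesis using A contract_nbr[of x] nbr[of x] by (simp add: lift_def)
next
  case (B x)
  then have "{q, x} - {q} = {x}" "x \<notin> A" using nbrD[of x] disj by auto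
  then show ?thesis using B contract_nbr[of x] nbr[of x] by (simp add: lift_def)
next
  case a
  then have "{q, a} - {q} = {a}" using nbrD[of a] by auto
  then show ?thesis using a contract_nbr[of a] nbr[of a] disj by (simp add: lift_def)
qed auto

lemma contract_inj:
  assumes "f \<in> ES" "g \<in> ES" "contract ` f = contract ` g" "contract ` f \<in> ET"
  shows "f = g"
proof -
  have "{q} \<notin> ET" using graph unfolding graph_def by force
  then show ?thesis using contract_ES[OF assms(1)] contract_ES[OF assms(2)] assms(3,4) by metis
qed

lemma lift_ES:
  assumes "e \<in> ET"
  obtains f where "f \<in> ES" "contract ` f = e"
proof (cases "q \<in> e")
  case False
  then have "e \<in> ES" using assms by (simp add: ES_def)
  moreover have "contract ` e = e"
    using assms graph fresh unfolding graph_def by (intro contract_old) blast+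
  ultimately show ?thesis using that by blast
next
  case True
  then obtain x where x: "e = {q, x}" using graph_edgeE[OF graph assms]
    by (metis insertE insert_commute singletonD)
  then consider "x = a" | "x \<in> A" | "x \<in> B" using assms nbr by blast
  then show ?thesis
  proof cases
    case 1
    then show ?thesis using that[of "{z, a}"] x contract_nbr[of a] by (simp add: ES_def)
  next
    case 2
    then show ?thesis using that[of "{q, x}"] x contract_nbr[of x] by (simp add: ES_def)
  next
    case 3
    then show ?thesis using that[of "{q', x}"] x contract_nbr[of x] by (simp add: ES_def)
  qed
qed

section \<open>The split graph is again a tree\<close>

lemma graph_split: "graph VS ES"
proof -
  have "e \<subseteq> VS \<and> card e = 2" if "e \<in> ES" for e
    using that
  proof (cases rule: ES_cases)
    case old
    then show ?thesis using graph by (auto simp: graph_def VS_def)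
  next
    case (A x)
    then show ?thesis using nbrD[of x] q by (simp add: VS_def card_insert_if)
  next
    case (B x)
    then show ?thesis using nbrD[of x] by (simp add: VS_def card_insert_if)
  next
    case a
    then show ?thesis using nbrD[of a] by (simp add: VS_def card_insert_if)
  qed (use q q_neq in \<open>simp_all add: VS_def card_insert_if\<close>)
  then show ?thesis using finite_VT by (simp add: graph_def VS_def)
qed

lemma crosses_contract: "crosses f (contract -` S) \<longleftrightarrow> crosses (contract ` f) S"
  by (auto simp: crosses_def)

text \<open>A cut separating \<open>z\<close> from \<open>q\<close> or \<open>q'\<close> is crossed
  by a new edge. Any other cut is its own preimage under \<open>contract\<close>, so an old edge
  crossing it lifts to one that does.\<close>

lemma cut_connected_split: "cut_connected VS ES"
  unfolding cut_connected_def
proof (intro allI impI)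
  fix S assume S: "VS \<inter> S \<noteq> {} \<and> \<not> VS \<subseteq> S"
  have zq: "{z, q} \<in> ES" "{z, q'} \<in> ES" by (auto simp: ES_def)
  show "\<exists>e\<in>ES. crosses e S"
  proof (cases "(q \<in> S) = (z \<in> S) \<and> (q' \<in> S) = (z \<in> S)")
    case False
    then have "crosses {z, q} S \<or> crosses {z, q'} S" by (auto simp: crosses_pair)
    then show ?thesis using zq by blast
  next
    case True
    have "VT \<inter> S \<noteq> {} \<and> \<not> VT \<subseteq> S" using S True q unfolding VS_def by blast
    then obtain e where e: "e \<in> ET" "crosses e S" using cut[of S] by blast
    obtain f where f: "f \<in> ES" "contract ` f = e" using lift_ES[OF e(1)] .
    have "contract -` S = S" using True by (auto simp: contract_def split: if_splits)
    then have "crosses f S" using crosses_contract[of f S] f e by simp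
    then show ?thesis using f by blast
  qed
qed

text \<open>The witness is \<open>r\<close> together with the branches of the old tree that are now
  attached to \<open>r\<close>. Restricting the sides to \<open>VT\<close> keeps the fresh vertices
  out of these branches.\<close>

lemma bridge_new:
  assumes "r = q \<and> C = A \<or> r = q' \<and> C = B"
  shows "\<exists>S. crosses {z, r} S \<and> (\<forall>f\<in>ES. crosses f S \<longrightarrow> f = {z, r})"
proof -
  have nC: "x = a \<or> x \<in> A \<or> x \<in> B" if "x \<in> C" for x using assms that by blast
  then have xE: "{q, x} \<in> ET" if "x \<in> C" for x using nbr that by blast
  define S where "S = insert r (\<Union>x\<in>C. side ET q x \<inter> VT)"
  have qS: "q \<notin> side ET q x" if "x \<in> C" for x using side(2)[OF xE[OF that]] .
  have q_S: "q \<in> S \<longleftrightarrow> r = q" using qS by (auto simp: S_def)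
  have q'_S: "q' \<in> S \<longleftrightarrow> r = q'" using fresh by (auto simp: S_def)
  have z_S: "z \<notin> S" using fresh q_neq assms by (auto simp: S_def)
  have in_S: "y \<in> S \<longleftrightarrow> y \<in> C" if y: "y = a \<or> y \<in> A \<or> y \<in> B" for y
  proof
    assume "y \<in> C"
    then show "y \<in> S" using side(1)[OF xE] nbrD(1)[OF y] by (auto simp: S_def)
  next
    assume "y \<in> S"
    moreover have "y \<noteq> r" using nbrD[OF y] assms by blast
    ultimately obtain x where x: "x \<in> C" "y \<in> side ET q x" by (auto simp: S_def)
    have "{q, y} \<in> ET" using nbr y by blast
    then have "{q, y} = {q, x}" using side_edge[OF xE[OF x(1)], of q y] x qS by blast
    then have "y = x" using nbrD(2)[OF y] by (auto simp: doubleton_eq_iff)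
    then show "y \<in> C" using x by simp
  qed
  have "f = {z, r}" if fE: "f \<in> ES" and fS: "crosses f S" for f
    using fE
  proof (cases rule: ES_cases)
    case old
    obtain s t where st: "f = {s, t}" "s \<in> S" "t \<notin> S" "s \<in> VT" "t \<in> VT"
      using graph_edgeE[OF graph old(1)] fS by (metis crosses_pair insert_commute)
    moreover have "s \<noteq> r" using st(1) old assms by blast
    ultimately obtain x where x: "x \<in> C" "s \<in> side ET q x" by (auto simp: S_def)
    then have "t \<notin> side ET q x" using st by (auto simp: S_def)
    then have "f = {q, x}" using side_edge[OF xE[OF x(1)], of s t] x st old by blast
    then show ?thesis using old by blast
  next
    case (A x)
    then have "(q \<in> S) \<noteq> (x \<in> S)" using fS by (simp add: crosses_pair)
    moreover have "(x \<in> S) = (r = q)" using in_S[of x] A assms disj q_neq by blast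
    ultimately show ?thesis using q_S by simp
  next
    case (B x)
    then have "(q' \<in> S) \<noteq> (x \<in> S)" using fS by (simp add: crosses_pair)
    moreover have "(x \<in> S) = (r = q')" using in_S[of x] B assms disj q_neq by blast
    ultimately show ?thesis using q'_S by simp
  next
    case a
    then have "(z \<in> S) \<noteq> (a \<in> S)" using fS by (simp add: crosses_pair)
    moreover have "a \<notin> S" using in_S[of a] assms disj by blast
    ultimately show ?thesis using z_S by simp
  next
    case q
    then have "q \<in> S" using fS z_S by (simp add: crosses_pair)
    then show ?thesis using q q_S by simp
  next
    case q'
    then have "q' \<in> S" using fS z_S by (simp add: crosses_pair)
    then show ?thesis using q' q'_S by simp
  qed
  moreover have "crosses {z, r} S" using z_S by (simp add: crosses_pair S_def)
  ultimately show ?thesis by blast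
qed

text \<open>For an inherited edge the old cut is pulled back along \<open>contract\<close>; the two
  collapsed edges become singletons and cannot cross it.\<close>

lemma all_bridges_split: "all_bridges ES"
  unfolding all_bridges_def
proof
  fix e assume e: "e \<in> ES"
  show "\<exists>S. crosses e S \<and> (\<forall>f\<in>ES. crosses f S \<longrightarrow> f = e)"
  proof (cases "contract ` e \<in> ET")
    case False
    then have "e = {z, q} \<or> e = {z, q'}" using contract_ES[OF e] by blast
    then show ?thesis using bridge_new[of q A] bridge_new[of q' B] by blast
  next
    case True
    then obtain S where S: "crosses (contract ` e) S" "\<And>f. f \<in> ET \<Longrightarrow> crosses f S \<Longrightarrow> f = contract ` e"
      using tree unfolding is_tree_iff_cut all_bridges_def by meson
    have "f = e" if f: "f \<in> ES" "crosses f (contract -` S)" for f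
    proof -
      have c: "crosses (contract ` f) S" using f(2) by (simp add: crosses_contract)
      moreover have "\<not> crosses {q} S" by (auto simp: crosses_def)
      ultimately have "contract ` f \<noteq> {q}" by metis
      then have "contract ` f \<in> ET" using contract_ES[OF f(1)] by blast
      then show ?thesis using contract_inj[OF f(1) e] S(2) c by simp
    qed
    moreover have "crosses e (contract -` S)" using S(1) by (simp add: crosses_contract)
    ultimately show ?thesis by blast
  qed
qed

lemma tree_split: "is_tree VS ES"
  using graph_split cut_connected_split all_bridges_split
  by (simp add: is_tree_iff_cut VS_def)

section \<open>Degrees after the split\<close>

lemma finite_sides: "finite A" "finite B"
  using finite_nbrs[of q] unfolding nbrs by auto

lemma degree_split_old:
  assumes x: "x \<in> VT" "x \<noteq> q"
  shows "degree ES x \<le> degree ET x"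
proof -
  have fin: "finite {e \<in> ET. x \<in> e}" using graph_finite_edges[OF graph] by simp
  have img: "contract ` f \<in> ET \<and> x \<in> contract ` f" if "f \<in> ES" "x \<in> f" for f
  proof -
    have "\<not> (f = {z, q} \<or> f = {z, q'})" using that(2) x fresh by auto
    then have "contract ` f \<in> ET" using contract_ES[OF that(1)] by blast
    moreover have "x \<in> contract ` f" using that(2) contract_id[OF x(1)] by force
    ultimately show ?thesis by blast
  qed
  have "inj_on ((`) contract) {e \<in> ES. x \<in> e}"
    using contract_inj img by (intro inj_onI) blast
  moreover have "(`) contract ` {e \<in> ES. x \<in> e} \<subseteq> {e \<in> ET. x \<in> e}" using img by blast
  ultimately show ?thesis unfolding degree_def using fin by (rule card_inj_on_le)
qed

lemma degree_split_q: "degree ES q \<le> card A + 1"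
proof -
  have "{e \<in> ES. q \<in> e} \<subseteq> insert {z, q} ((\<lambda>x. {q, x}) ` A)"
  proof
    fix e assume "e \<in> {e \<in> ES. q \<in> e}"
    then have "e \<in> ES" "q \<in> e" by auto
    then show "e \<in> insert {z, q} ((\<lambda>x. {q, x}) ` A)"
      by (cases rule: ES_cases) (use q_neq nbrD in blast)+
  qed
  then have "card {e \<in> ES. q \<in> e} \<le> card (insert {z, q} ((\<lambda>x. {q, x}) ` A))"
    using finite_sides by (intro card_mono) auto
  also have "\<dots> \<le> Suc (card ((\<lambda>x. {q, x}) ` A))" by (rule card_insert_le_m1) simp_all
  also have "\<dots> \<le> card A + 1" using card_image_le[OF finite_sides(1)] by simp
  finally show ?thesis by (simp add: degree_def)
qed

lemma degree_split_q': "degree ES q' \<le> card B + 1"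
proof -
  have "{e \<in> ES. q' \<in> e} \<subseteq> insert {z, q'} ((\<lambda>x. {q', x}) ` B)"
  proof
    fix e assume "e \<in> {e \<in> ES. q' \<in> e}"
    then have "e \<in> ES" "q' \<in> e" by auto
    then show "e \<in> insert {z, q'} ((\<lambda>x. {q', x}) ` B)"
      by (cases rule: ES_cases) (use q_neq nbrD in blast)+
  qed
  then have "card {e \<in> ES. q' \<in> e} \<le> card (insert {z, q'} ((\<lambda>x. {q', x}) ` B))"
    using finite_sides by (intro card_mono) auto
  also have "\<dots> \<le> Suc (card ((\<lambda>x. {q', x}) ` B))" by (rule card_insert_le_m1) simp_all
  also have "\<dots> \<le> card B + 1" using card_image_le[OF finite_sides(2)] by simp
  finally show ?thesis by (simp add: degree_def)
qed

lemma degree_split_z: "degree ES z \<le> 3"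
proof -
  have "{e \<in> ES. z \<in> e} \<subseteq> {{z, a}, {z, q}, {z, q'}}"
  proof
    fix e assume "e \<in> {e \<in> ES. z \<in> e}"
    then have "e \<in> ES" "z \<in> e" by auto
    then show "e \<in> {{z, a}, {z, q}, {z, q'}}"
      by (cases rule: ES_cases) (use q_neq nbrD in blast)+
  qed
  then have "card {e \<in> ES. z \<in> e} \<le> card {{z, a}, {z, q}, {z, q'}}" by (intro card_mono) auto
  also have "\<dots> \<le> 3" by (simp add: card_insert_if)
  finally show ?thesis by (simp add: degree_def)
qed

text \<open>The degree \<open>card A + card B + 1\<close> of \<open>q\<close> is replaced by at most
  \<open>card A + 1\<close> and \<open>card B + 1\<close>, and \<open>z\<close> contributes nothing.
  The bound 4 excludes \<open>card A = card B = 1\<close>, where \<open>q\<close> has no excess to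
  save.\<close>

lemma excess_split:
  assumes "A \<noteq> {}" "B \<noteq> {}" "degree ET q \<ge> 4"
  shows "excess VS ES < excess VT ET"
proof -
  have "degree ET q = card (insert a (A \<union> B))" using degree_nbrs[OF q] nbrs by simp
  also have "\<dots> = card A + card B + 1" using finite_sides disj by (simp add: card_Un_disjoint)
  finally have d: "degree ET q = card A + card B + 1" .
  have pos: "card A \<ge> 1" "card B \<ge> 1" using assms finite_sides by (simp_all add: Suc_le_eq card_gt_0_iff)
  have le: "(\<Sum>x\<in>VT - {q}. degree ES x - 3) \<le> (\<Sum>x\<in>VT - {q}. degree ET x - 3)"
    using degree_split_old by (intro sum_mono diff_le_mono) auto
  have "excess VS ES = (degree ES q' - 3) + ((degree ES z - 3) + (\<Sum>x\<in>VT. degree ES x - 3))"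
    unfolding excess_def VS_def using finite_VT fresh by simp
  also have "(\<Sum>x\<in>VT. degree ES x - 3) = (degree ES q - 3) + (\<Sum>x\<in>VT - {q}. degree ES x - 3)"
    using finite_VT q by (simp add: sum.remove)
  finally have 1: "excess VS ES \<le> (card B + 1 - 3) + (card A + 1 - 3) + (\<Sum>x\<in>VT - {q}. degree ET x - 3)"
    using degree_split_q degree_split_q' degree_split_z le by linarith
  have "excess VT ET = (degree ET q - 3) + (\<Sum>x\<in>VT - {q}. degree ET x - 3)"
    unfolding excess_def using finite_VT q by (simp add: sum.remove)
  then show ?thesis using 1 d pos assms(3) by linarith
qed

text \<open>The last clause is the purpose of \<open>z\<close>: a path that uses one of the two
  edges collapsed by \<open>contract\<close> also uses \<open>{z, a}\<close>. Two paths sharing a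
  collapsed edge thus share an inherited one as well, so no new intersections arise.\<close>

definition lifts :: "'b list \<Rightarrow> 'b list \<Rightarrow> bool" where
  "lifts ps ps' \<longleftrightarrow> tree_subpath VS ES ps' \<and>
    (\<forall>f\<in>ES. contract ` f \<in> ET \<longrightarrow> (f \<in> path_edges ps' \<longleftrightarrow> contract ` f \<in> path_edges ps)) \<and>
    ({z, q} \<in> path_edges ps' \<or> {z, q'} \<in> path_edges ps' \<longrightarrow> {z, a} \<in> path_edges ps')"

text \<open>\<open>R\<close> accounts for the singleton \<open>{q}\<close> to which a new edge at
  \<open>z\<close> collapses when the lifted path is contracted. It is no tree edge, so the
  inherited edges are compared correctly.\<close>

lemma liftsI:
  assumes "tree_subpath VS ES ps'"
    and pe: "path_edges (map contract ps') = path_edges ps \<union> R" "R \<subseteq> {{q}}"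
    and z: "z \<in> set ps' \<Longrightarrow> {z, a} \<in> path_edges ps'"
  shows "lifts ps ps'"
proof -
  have "{q} \<notin> ET" using graph unfolding graph_def by force
  have sub: "path_edges ps' \<subseteq> ES" using assms(1) by (simp add: tree_subpath_def is_path_def)
  have "f \<in> path_edges ps' \<longleftrightarrow> contract ` f \<in> path_edges ps" if f: "f \<in> ES" "contract ` f \<in> ET" for f
  proof
    assume "f \<in> path_edges ps'"
    then have "contract ` f \<in> path_edges ps \<union> R" using pe(1) by (auto simp: path_edges_map)
    then show "contract ` f \<in> path_edges ps" using f(2) \<open>{q} \<notin> ET\<close> pe(2) by auto
  next
    assume "contract ` f \<in> path_edges ps"
    then have "contract ` f \<in> (`) contract ` path_edges ps'" using pe(1) by (simp add: path_edges_map)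
    then obtain g where "g \<in> path_edges ps'" "contract ` f = contract ` g" by blast
    then show "f \<in> path_edges ps'" using contract_inj[OF f(1) _ _ f(2)] sub by blast
  qed
  then show ?thesis unfolding lifts_def using assms(1) z path_edge_in_set by metis
qed

lemma path_lifts:
  assumes ps: "tree_subpath VT ET ps"
    and no: "\<And>x y. x \<in> A \<Longrightarrow> y \<in> B \<Longrightarrow> {q, x} \<in> path_edges ps \<Longrightarrow> {q, y} \<in> path_edges ps \<Longrightarrow> False"
  shows "\<exists>ps'. lifts ps ps'"
proof (cases "q \<in> set ps")
  case False
  have "map contract ps = ps"
    using ps contract_id by (intro map_idI) (auto simp: tree_subpath_def is_path_def)
  moreover have "q \<notin> e" if "e \<in> path_edges ps" for e using path_edges_subset[OF that] False by blast
  then have "path_edges ps \<subseteq> ES" using ps by (auto simp: ES_def tree_subpath_def is_path_def)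
  then have "tree_subpath VS ES ps" using ps by (auto simp: tree_subpath_def is_path_def VS_def)
  moreover have "z \<notin> set ps" using ps fresh by (auto simp: tree_subpath_def is_path_def)
  ultimately show ?thesis by (intro exI liftsI[where R = "{}"]) auto
next
  case True
  then obtain l1 l2 where l: "ps = l1 @ q # l2" by (meson split_list)
  have ps': "distinct (l1 @ q # l2)" "set l1 \<subseteq> VT" "set l2 \<subseteq> VT" "path_edges ps \<subseteq> ET" "length ps \<ge> 2"
    using ps l by (auto simp: tree_subpath_def is_path_def)
  have at: "{q, x} \<in> path_edges ps \<longleftrightarrow> l1 \<noteq> [] \<and> x = last l1 \<or> l2 \<noteq> [] \<and> x = hd l2" for x
    using path_edges_at[OF ps'(1)] l by simp
  have n1: "last l1 = a \<or> last l1 \<in> A \<or> last l1 \<in> B" if "l1 \<noteq> []" using at ps'(4) that nbr by blast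
  have n2: "hd l2 = a \<or> hd l2 \<in> A \<or> hd l2 \<in> B" if "l2 \<noteq> []" using at ps'(4) that nbr by blast
  have ne: "last l1 \<noteq> hd l2" if "l1 \<noteq> []" "l2 \<noteq> []"
  proof -
    have "set l1 \<inter> set l2 = {}" using ps'(1) by auto
    then show ?thesis using last_in_set[OF that(1)] hd_in_set[OF that(2)] by auto
  qed
  have nAB: "\<not> (last l1 \<in> A \<and> hd l2 \<in> B)" "\<not> (last l1 \<in> B \<and> hd l2 \<in> A)" if "l1 \<noteq> []" "l2 \<noteq> []"
    using no at that by blast+
  have pe1: "path_edges l1 \<subseteq> ES" "path_edges l2 \<subseteq> ES"
  proof -
    have "e \<in> ES" if "e \<in> path_edges l1 \<or> e \<in> path_edges l2" for e
    proof -
      have "e \<in> path_edges ps" using that unfolding l by (auto simp: path_edges_append path_edges_Cons)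
      moreover have "q \<notin> e" using that path_edges_subset[of e l1] path_edges_subset[of e l2] ps'(1) by auto
      ultimately show ?thesis using ps'(4) by (auto simp: ES_def)
    qed
    then show "path_edges l1 \<subseteq> ES" "path_edges l2 \<subseteq> ES" by blast+
  qed
  have ctr: "map contract l1 = l1" "map contract l2 = l2"
    using ps'(2,3) contract_id by (auto intro!: map_idI)
  \<comment> \<open>\<open>M\<close> takes the place of \<open>q\<close> and consists of one or two
    of the vertices that contract to \<open>q\<close>. Allowing \<open>z\<close> only next to
    \<open>a\<close> secures the last clause of \<open>lifts\<close>.\<close>
  have main: "lifts ps (l1 @ M @ l2)"
    if M: "M \<noteq> []" "distinct M" "set M \<subseteq> {q, q', z}" "length M \<le> 2" "path_edges M \<subseteq> ES"
      and e1: "l1 \<noteq> [] \<Longrightarrow> {last l1, hd M} \<in> ES"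
      and e2: "l2 \<noteq> [] \<Longrightarrow> {last M, hd l2} \<in> ES"
      and z: "z \<in> set M \<Longrightarrow> l1 \<noteq> [] \<and> last l1 = a \<and> hd M = z \<or> l2 \<noteq> [] \<and> hd l2 = a \<and> last M = z"
    for M
  proof (rule liftsI[where R = "if length M = 2 then {{q}} else {}"])
    have "distinct (l1 @ M @ l2)" using M ps' fresh by auto
    moreover have "set (l1 @ M @ l2) \<subseteq> VS" using M(3) ps' q by (auto simp: VS_def)
    moreover have "path_edges (l1 @ M @ l2) \<subseteq> ES"
      using pe1 M(1,5) e1 e2 by (auto simp: path_edges_append)
    moreover have "length (l1 @ M @ l2) \<ge> 2" using M(1) ps'(5) l by (cases M) auto
    ultimately show "tree_subpath VS ES (l1 @ M @ l2)" using M(1) by (simp add: tree_subpath_def is_path_def)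
    have cM: "contract x = q" if "x \<in> set M" for x using M(3) that by auto
    obtain m M' where m: "M = m # M'" using M(1) by (cases M) auto
    have "map contract M = (if length M = 2 then [q, q] else [q])"
    proof (cases M')
      case Nil
      then show ?thesis using m cM by simp
    next
      case (Cons m' M'')
      then have "M'' = []" using M(4) m by simp
      then show ?thesis using m cM Cons by simp
    qed
    then show "path_edges (map contract (l1 @ M @ l2)) = path_edges ps \<union> (if length M = 2 then {{q}} else {})"
      unfolding l map_append ctr by (auto simp: path_edges_append path_edges_Cons)
    show "(if length M = 2 then {{q}} else {}) \<subseteq> {{q}}" by simp
    assume "z \<in> set (l1 @ M @ l2)"
    then have "z \<in> set M" using ps' fresh by auto
    then show "{z, a} \<in> path_edges (l1 @ M @ l2)"
      using z M(1) by (auto simp: path_edges_append insert_commute)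
  qed
  have EA: "{q, x} \<in> ES" "{x, q} \<in> ES" if "x \<in> A" for x using that by (auto simp: ES_def insert_commute)
  have EB: "{q', x} \<in> ES" "{x, q'} \<in> ES" if "x \<in> B" for x using that by (auto simp: ES_def insert_commute)
  have Ez: "{z, a} \<in> ES" "{a, z} \<in> ES" "{z, q} \<in> ES" "{q, z} \<in> ES" "{z, q'} \<in> ES" "{q', z} \<in> ES"
    by (auto simp: ES_def insert_commute)
  show ?thesis
  proof (cases "l1 \<noteq> [] \<and> last l1 = a")
    case a1: True
    show ?thesis
    proof (cases "l2 \<noteq> [] \<and> hd l2 \<in> B")
      case True
      show ?thesis
        by (rule exI, rule main[of "[z, q']"]) (use a1 True q_neq Ez EB in auto)
    next
      case False
      \<comment> \<open>This case includes paths that arrive from \<open>a\<close> and end at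
        \<open>q\<close>; their lifts end at \<open>q\<close> too.\<close>
      then have "hd l2 \<in> A" if "l2 \<noteq> []" using n2 ne a1 that by auto
      then show ?thesis
        by - (rule exI, rule main[of "[z, q]"], use a1 q_neq Ez EA in auto)
    qed
  next
    case na1: False
    show ?thesis
    proof (cases "l2 \<noteq> [] \<and> hd l2 = a")
      case a2: True
      show ?thesis
      proof (cases "l1 \<noteq> [] \<and> last l1 \<in> B")
        case True
        show ?thesis
          by (rule exI, rule main[of "[q', z]"]) (use a2 True q_neq Ez EB in auto)
      next
        case False
        then have "last l1 \<in> A" if "l1 \<noteq> []" using n1 na1 that by auto
        then show ?thesis
          by - (rule exI, rule main[of "[q, z]"], use a2 q_neq Ez EA in auto)
      qed
    next
      case na2: False
      show ?thesis
      proof (cases "l1 \<noteq> [] \<and> last l1 \<in> B \<or> l2 \<noteq> [] \<and> hd l2 \<in> B")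
        case True
        then have "last l1 \<in> B" if "l1 \<noteq> []" using n1 nAB na1 that by auto
        moreover have "hd l2 \<in> B" if "l2 \<noteq> []" using n2 nAB na2 True that by auto
        ultimately show ?thesis
          by - (rule exI, rule main[of "[q']"], use q_neq EB in auto)
      next
        case False
        then have "last l1 \<in> A" if "l1 \<noteq> []" using n1 na1 that by auto
        moreover have "hd l2 \<in> A" if "l2 \<noteq> []" using n2 na2 False that by auto
        ultimately show ?thesis
          by - (rule exI, rule main[of "[q]"], use q_neq EA in auto)
      qed
    qed
  qed
qed

text \<open>A common edge of old paths lifts to a common edge of the new ones, and a shared
  collapsed edge can be exchanged for \<open>{z, a}\<close>. So the same pairs of paths meet, and
  the Helly property carries over.\<close>

lemma rep_split:
  assumes rep: "helly_ept_rep V E VT ET P"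
    and no: "\<And>v x y. v \<in> V \<Longrightarrow> x \<in> A \<Longrightarrow> y \<in> B \<Longrightarrow> {q, x} \<in> path_edges (P v) \<Longrightarrow>
      {q, y} \<in> path_edges (P v) \<Longrightarrow> False"
  obtains P' where "helly_ept_rep V E VS ES P'"
proof -
  have ept: "ept_rep V E VT ET P" and helly: "helly_family V (\<lambda>v. path_edges (P v))"
    using rep by (auto simp: helly_ept_rep_def)
  have "\<forall>v\<in>V. \<exists>ps'. lifts (P v) ps'"
  proof
    fix v assume v: "v \<in> V"
    then have "tree_subpath VT ET (P v)" using ept by (simp add: ept_rep_def)
    then show "\<exists>ps'. lifts (P v) ps'" using no[OF v] by (rule path_lifts)
  qed
  then obtain P' where P': "\<And>v. v \<in> V \<Longrightarrow> lifts (P v) (P' v)" by metis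
  have sub: "tree_subpath VS ES (P' v)" if "v \<in> V" for v using P'[OF that] by (simp add: lifts_def)
  then have subE: "path_edges (P' v) \<subseteq> ES" if "v \<in> V" for v
    using that by (simp add: tree_subpath_def is_path_def)
  have lift: "f \<in> path_edges (P' v) \<longleftrightarrow> contract ` f \<in> path_edges (P v)"
    if "v \<in> V" "f \<in> ES" "contract ` f \<in> ET" for v f
    using P'[OF that(1)] that(2,3) by (simp add: lifts_def)
  have common: "\<exists>f. f \<in> ES \<and> (\<forall>v\<in>S. f \<in> path_edges (P' v))"
    if S: "S \<subseteq> V" "e \<in> ET" "\<And>v. v \<in> S \<Longrightarrow> e \<in> path_edges (P v)" for S e
  proof -
    obtain f where "f \<in> ES" "contract ` f = e" using lift_ES[OF S(2)] .
    then show ?thesis using lift S by blast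
  qed
  have meet: "path_edges (P' v) \<inter> path_edges (P' w) \<noteq> {} \<longleftrightarrow> path_edges (P v) \<inter> path_edges (P w) \<noteq> {}"
    if v: "v \<in> V" and w: "w \<in> V" for v w
  proof
    assume "path_edges (P' v) \<inter> path_edges (P' w) \<noteq> {}"
    then obtain f where f: "f \<in> path_edges (P' v)" "f \<in> path_edges (P' w)" by blast
    have "\<exists>g. g \<in> ES \<and> contract ` g \<in> ET \<and> g \<in> path_edges (P' v) \<and> g \<in> path_edges (P' w)"
    proof (cases "contract ` f \<in> ET")
      case True
      then show ?thesis using f subE v by blast
    next
      case False
      have "f \<in> ES" using f subE v by blast
      then have "f = {z, q} \<or> f = {z, q'}" using contract_ES[of f] False by blast
      then have "{z, a} \<in> path_edges (P' v)" "{z, a} \<in> path_edges (P' w)"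
        using P'[OF v] P'[OF w] f unfolding lifts_def by metis+
      moreover have "{z, a} \<in> ES" by (simp add: ES_def)
      moreover have "contract ` {z, a} \<in> ET" using contract_nbr[of a] nbr[of a] by simp
      ultimately show ?thesis by blast
    qed
    then show "path_edges (P v) \<inter> path_edges (P w) \<noteq> {}" using lift v w by blast
  next
    assume "path_edges (P v) \<inter> path_edges (P w) \<noteq> {}"
    then obtain e where e: "e \<in> path_edges (P v)" "e \<in> path_edges (P w)" by blast
    have "e \<in> ET" using e ept v unfolding ept_rep_def tree_subpath_def is_path_def by blast
    then show "path_edges (P' v) \<inter> path_edges (P' w) \<noteq> {}"
      using common[of "{v, w}" e] e v w by auto
  qed
  have "helly_family V (\<lambda>v. path_edges (P' v))"
    unfolding helly_family_def
  proof (intro allI impI, elim conjE)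
    fix S assume S: "S \<subseteq> V" "S \<noteq> {}" "\<forall>v\<in>S. \<forall>w\<in>S. path_edges (P' v) \<inter> path_edges (P' w) \<noteq> {}"
    then have "\<forall>v\<in>S. \<forall>w\<in>S. path_edges (P v) \<inter> path_edges (P w) \<noteq> {}"
      using meet by (metis subsetD)
    then have "(\<Inter>v\<in>S. path_edges (P v)) \<noteq> {}" using helly S(1,2) by (simp add: helly_family_def)
    then obtain e where e: "e \<in> (\<Inter>v\<in>S. path_edges (P v))" by (meson equals0I)
    obtain v where "v \<in> S" using S by blast
    then have "e \<in> path_edges (P v)" "v \<in> V" using e S by auto
    then have "e \<in> ET" using ept unfolding ept_rep_def tree_subpath_def is_path_def by blast
    then obtain f where "\<forall>v\<in>S. f \<in> path_edges (P' v)" using common[OF S(1), of e] e by auto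
    then show "(\<Inter>v\<in>S. path_edges (P' v)) \<noteq> {}" by auto
  qed
  moreover have "ept_rep V E VS ES P'"
    using ept meet sub tree_split unfolding ept_rep_def by simp
  ultimately show ?thesis using that by (simp add: helly_ept_rep_def)
qed

end

subsection \<open>Splitting or finding a gate\<close>

text \<open>The bound 4 serves twice: \<open>line_graph_has_gate\<close> asks for that many
  neighbours, and splitting such a vertex lowers the excess.\<close>

lemma split_or_gate:
  fixes VT :: "nat set"
  assumes g: "graph V E" and rep: "helly_ept_rep V E VT ET P" and q: "q \<in> VT" and d: "degree ET q \<ge> 4"
  shows "has_induced_k_gate V E (degree ET q) \<or>
    (\<exists>(VT' :: nat set) ET' P'. helly_ept_rep V E VT' ET' P' \<and> excess VT' ET' < excess VT ET)"
proof -
  have ept: "ept_rep V E VT ET P" and helly: "helly_family V (\<lambda>v. path_edges (P v))"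
    using rep by (auto simp: helly_ept_rep_def)
  interpret tree VT ET using ept by unfold_locales (simp add: ept_rep_def)
  have path: "is_path VT ET (P v)" "distinct (P v)" if "v \<in> V" for v
    using ept that by (auto simp: ept_rep_def tree_subpath_def is_path_def)
  define N where "N = {x. {q, x} \<in> ET}"
  define F where "F = {{x, y} | x y. x \<noteq> y \<and> (\<exists>v\<in>V. {q, x} \<in> path_edges (P v) \<and> {q, y} \<in> path_edges (P v))}"
  have dN: "degree ET q = card N" using degree_nbrs[OF q] by (simp add: N_def)
  have nbrN: "x \<in> N" if "v \<in> V" "{q, x} \<in> path_edges (P v)" for v x
    using path(1)[OF that(1)] that(2) by (auto simp: N_def is_path_def)
  show ?thesis
  proof (cases "twoconn N F")
    case True
    \<comment> \<open>Any vertex realising \<open>f\<close> will do. Its path has no third edge at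
      \<open>q\<close>, so \<open>f\<close> can be read off from it, which makes
      \<open>\<phi>\<close> injective.\<close>
    define \<phi> where "\<phi> f = (SOME v. v \<in> V \<and> (\<forall>x\<in>f. {q, x} \<in> path_edges (P v)))" for f
    have phi: "\<phi> f \<in> V" "{q, x} \<in> path_edges (P (\<phi> f)) \<longleftrightarrow> x \<in> f" if f: "f \<in> F" for f x
    proof -
      obtain u w v where uw: "f = {u, w}" "u \<noteq> w" and v: "v \<in> V \<and> (\<forall>x\<in>f. {q, x} \<in> path_edges (P v))"
        using f unfolding F_def by blast
      have *: "\<phi> f \<in> V \<and> (\<forall>x\<in>f. {q, x} \<in> path_edges (P (\<phi> f)))"
        unfolding \<phi>_def using v by (rule someI)
      then show "\<phi> f \<in> V" by blast
      show "{q, x} \<in> path_edges (P (\<phi> f)) \<longleftrightarrow> x \<in> f"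
        using * path_at_most_two[of "P (\<phi> f)" q u w x] path(2) uw by auto
    qed
    have qP: "q \<in> set (P (\<phi> f))" if f: "f \<in> F" for f
    proof -
      have "f \<noteq> {}" using f by (auto simp: F_def)
      then obtain x where "x \<in> f" by blast
      then show ?thesis using phi(2)[OF f] path_edge_in_set by metis
    qed
    \<comment> \<open>A common tree edge of these paths can be moved to \<open>q\<close>, where it
      becomes a common end of the local edges.\<close>
    have shared: "\<exists>w. \<forall>f\<in>S. w \<in> f" if S: "S \<subseteq> F" "e \<in> ET" "\<And>f. f \<in> S \<Longrightarrow> e \<in> path_edges (P (\<phi> f))" for S e
    proof -
      obtain w where w: "{q, w} \<in> ET"
        "\<And>ps. is_path VT ET ps \<Longrightarrow> q \<in> set ps \<Longrightarrow> e \<in> path_edges ps \<Longrightarrow> {q, w} \<in> path_edges ps"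
        by (rule path_edge_at[OF q S(2)], rule that) blast+
      have "w \<in> f" if f: "f \<in> S" for f
      proof -
        have fF: "f \<in> F" using f S(1) by blast
        show ?thesis using w(2)[OF path(1)[OF phi(1)[OF fF]] qP[OF fF] S(3)[OF f]] phi(2)[OF fF] by simp
      qed
      then show ?thesis by blast
    qed
    have inET: "e \<in> ET" if "e \<in> path_edges (P (\<phi> f))" "f \<in> F" for e f
      using path(1)[OF phi(1)[OF that(2)]] that(1) by (auto simp: is_path_def)
    have meet: "path_edges (P (\<phi> f)) \<inter> path_edges (P (\<phi> g)) \<noteq> {} \<longleftrightarrow> f \<inter> g \<noteq> {}"
      if fg: "f \<in> F" "g \<in> F" for f g
    proof
      assume "path_edges (P (\<phi> f)) \<inter> path_edges (P (\<phi> g)) \<noteq> {}"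
      then obtain e where "e \<in> path_edges (P (\<phi> f))" "e \<in> path_edges (P (\<phi> g))" by blast
      then show "f \<inter> g \<noteq> {}" using shared[of "{f, g}" e] inET fg by auto
    next
      assume "f \<inter> g \<noteq> {}"
      then obtain x where "x \<in> f" "x \<in> g" by blast
      then show "path_edges (P (\<phi> f)) \<inter> path_edges (P (\<phi> g)) \<noteq> {}" using phi(2) fg by blast
    qed
    have inj: "inj_on \<phi> F"
    proof (rule inj_onI)
      fix f g assume "f \<in> F" "g \<in> F" "\<phi> f = \<phi> g"
      then have "x \<in> f \<longleftrightarrow> x \<in> g" for x using phi(2)[of f x] phi(2)[of g x] by simp
      then show "f = g" by blast
    qed
    have gF: "graph N F"
    proof -
      have "f \<subseteq> N \<and> card f = 2" if "f \<in> F" for f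
        using that nbrN by (auto simp: F_def)
      then show ?thesis using finite_nbrs[of q] by (simp add: graph_def N_def)
    qed
    \<comment> \<open>The three paths realising a triangle meet pairwise. The Helly property and
      \<open>shared\<close> would give a vertex lying on all three sides of the triangle.\<close>
    have tf: False if t: "{x, y} \<in> F" "{y, z} \<in> F" "{x, z} \<in> F" for x y z
    proof -
      have ne: "x \<noteq> y" "y \<noteq> z" "x \<noteq> z" using graph_edgeD[OF gF] t by blast+
      let ?T = "{{x, y}, {y, z}, {x, z}}"
      let ?S = "\<phi> ` ?T"
      have TF: "?T \<subseteq> F" using t by blast
      have SV: "?S \<subseteq> V" using phi(1) t by blast
      have "path_edges (P v) \<inter> path_edges (P w) \<noteq> {}" if vw: "v \<in> ?S" "w \<in> ?S" for v w
      proof -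
        obtain f k where fk: "v = \<phi> f" "w = \<phi> k" "f \<in> ?T" "k \<in> ?T" using vw by blast
        then have "f \<inter> k \<noteq> {}" by auto
        moreover have "f \<in> F" "k \<in> F" using fk(3,4) TF by blast+
        ultimately show ?thesis using meet fk(1,2) by simp
      qed
      then have "(\<Inter>v\<in>?S. path_edges (P v)) \<noteq> {}"
        using helly[unfolded helly_family_def, rule_format, OF SV] by blast
      then obtain e where e: "e \<in> (\<Inter>v\<in>?S. path_edges (P v))" by (meson equals0I)
      then have eT: "e \<in> path_edges (P (\<phi> f))" if "f \<in> ?T" for f using that by blast
      then have "e \<in> ET" using inET[of e "{x, y}"] t(1) by blast
      then obtain w where "\<forall>f\<in>?T. w \<in> f" using shared[OF TF _ eT] by blast
      then show False using ne by auto
    qed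
    have adj: "{\<phi> f, \<phi> k} \<in> E \<longleftrightarrow> f \<inter> k \<noteq> {}" if fk: "f \<in> F" "k \<in> F" "f \<noteq> k" for f k
    proof -
      have "\<phi> f \<noteq> \<phi> k" using inj fk by (meson inj_onD)
      then have "{\<phi> f, \<phi> k} \<in> E \<longleftrightarrow> path_edges (P (\<phi> f)) \<inter> path_edges (P (\<phi> k)) \<noteq> {}"
        using ept phi(1) fk by (simp add: ept_rep_def)
      then show ?thesis using meet fk by simp
    qed
    have E2: "card e = 2" if "e \<in> E" for e using g that by (simp add: graph_def)
    have N4: "card N \<ge> 4" using d dN by simp
    obtain S where S: "S \<subseteq> \<phi> ` F" "k_gate S (induced_edges E S) (card N)"
      by (rule line_graph_has_gate[OF gF N4 True tf inj adj E2])
    have "S \<subseteq> V" using S(1) phi(1) by blast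
    then show ?thesis using S(2) dN unfolding has_induced_k_gate_def by auto
  next
    case False
    then obtain a C where a: "a \<in> N" and C: "(N - {a}) \<inter> C \<noteq> {}" "\<not> N - {a} \<subseteq> C"
      and nF: "\<And>f. f \<in> F \<Longrightarrow> a \<in> f \<or> \<not> crosses f C"
      unfolding twoconn_def by meson
    obtain q' where q': "q' \<notin> VT" using finite_VT ex_new_if_finite[OF infinite_UNIV_nat] by blast
    obtain z where z: "z \<notin> insert q' VT"
      using finite_VT ex_new_if_finite[OF infinite_UNIV_nat, of "insert q' VT"] by auto
    \<comment> \<open>The two sides of the cut vertex \<open>a\<close>. A path using a neighbour
      from each would yield an edge of \<open>F\<close> that crosses \<open>C\<close> and avoids
      \<open>a\<close>.\<close>
    let ?A = "(N - {a}) \<inter> C" and ?B = "(N - {a}) - C"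
    interpret split_tree VT ET q a ?A ?B q' z
    proof
      show "{x. {q, x} \<in> ET} = insert a (?A \<union> ?B)" using a unfolding N_def by blast
    qed (use q q' z in auto)
    have "False" if "v \<in> V" "x \<in> ?A" "y \<in> ?B" "{q, x} \<in> path_edges (P v)" "{q, y} \<in> path_edges (P v)" for v x y
    proof -
      have "{x, y} \<in> F" using that unfolding F_def by blast
      moreover have "a \<notin> {x, y}" "crosses {x, y} C" using that by (auto simp: crosses_pair)
      ultimately show False using nF by blast
    qed
    then obtain P' where "helly_ept_rep V E VS ES P'" using rep_split[OF rep] by metis
    moreover have "excess VS ES < excess VT ET" using C d by (intro excess_split) auto
    ultimately show ?thesis by blast
  qed
qed

subsection \<open>Padding with leaves\<close>

lemma is_tree_add_leaf:
  assumes "is_tree V E" "x \<in> V" "w \<notin> V"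
  shows "is_tree (insert w V) (insert {w, x} E)"
proof -
  have g: "graph V E" and c: "cut_connected V E" and b: "all_bridges E"
    using assms by (auto simp: is_tree_iff_cut)
  have "w \<noteq> x" using assms by blast
  have we: "w \<notin> e" if "e \<in> E" for e using g that assms(3) unfolding graph_def by blast
  have "graph (insert w V) (insert {w, x} E)"
    using g assms \<open>w \<noteq> x\<close> by (auto simp: graph_def)
  moreover have "cut_connected (insert w V) (insert {w, x} E)"
    unfolding cut_connected_def
  proof (intro allI impI)
    fix S assume S: "insert w V \<inter> S \<noteq> {} \<and> \<not> insert w V \<subseteq> S"
    show "\<exists>e\<in>insert {w, x} E. crosses e S"
    proof (cases "(w \<in> S) = (x \<in> S)")
      case True
      then have "V \<inter> S \<noteq> {} \<and> \<not> V \<subseteq> S" using S assms(2) by blast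
      then show ?thesis using c unfolding cut_connected_def by blast
    qed (simp add: crosses_pair)
  qed
  moreover have "all_bridges (insert {w, x} E)"
    unfolding all_bridges_def
  proof
    fix e assume "e \<in> insert {w, x} E"
    then consider "e = {w, x}" | "e \<in> E" by blast
    then show "\<exists>S. crosses e S \<and> (\<forall>f\<in>insert {w, x} E. crosses f S \<longrightarrow> f = e)"
    proof cases
      case 1
      have "\<not> crosses f {w}" if "f \<in> E" for f using we[OF that] by (auto simp: crosses_def)
      then show ?thesis using 1 \<open>w \<noteq> x\<close> by (intro exI[of _ "{w}"]) (auto simp: crosses_pair)
    next
      case 2
      then obtain S where S: "crosses e S" "\<And>f. f \<in> E \<Longrightarrow> crosses f S \<Longrightarrow> f = e"
        using b unfolding all_bridges_def by meson
      \<comment> \<open>The old cut is altered at \<open>w\<close> only, so that the leaf lies on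
        the same side as \<open>x\<close> and its edge does not cross.\<close>
      let ?S = "if x \<in> S then insert w S else S - {w}"
      have same: "crosses f ?S \<longleftrightarrow> crosses f S" if "f \<in> E" for f
        using we[OF that] unfolding crosses_def by auto
      have "\<not> crosses {w, x} ?S" using \<open>w \<noteq> x\<close> by (auto simp: crosses_pair)
      then show ?thesis using S same 2 by (intro exI[of _ ?S]) blast
    qed
  qed
  ultimately show ?thesis by (simp add: is_tree_iff_cut)
qed

lemma max_degree_add_leaf:
  assumes g: "graph V E" and x: "x \<in> V" "degree E x = max_degree V E" and w: "w \<notin> V"
  shows "max_degree (insert w V) (insert {w, x} E) = Suc (max_degree V E)"
proof -
  let ?E = "insert {w, x} E"
  have fin: "finite V" "finite E" using g graph_finite_edges by (auto simp: graph_def)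
  have we: "w \<notin> e" if "e \<in> E" for e using g that w unfolding graph_def by blast
  then have new: "{w, x} \<notin> E" by blast
  have "{e \<in> ?E. x \<in> e} = insert {w, x} {e \<in> E. x \<in> e}" by auto
  then have dx: "degree ?E x = Suc (max_degree V E)"
    unfolding x(2)[symmetric] degree_def using fin new by simp
  have "{e \<in> ?E. w \<in> e} = {{w, x}}" using we by auto
  then have dw: "degree ?E w = 1" by (simp add: degree_def)
  have dy: "degree ?E y \<le> Suc (max_degree V E)" if "y \<in> V" for y
  proof (cases "y = x")
    case False
    then have "{e \<in> ?E. y \<in> e} = {e \<in> E. y \<in> e}" using that w by auto
    then have "degree ?E y = degree E y" by (simp add: degree_def)
    also have "\<dots> \<le> max_degree V E" unfolding max_degree_def using fin that by simp
    finally show ?thesis by simp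
  qed (simp add: dx)
  show ?thesis
    unfolding max_degree_def[of "insert w V"]
  proof (rule Max_eqI)
    show "finite (degree ?E ` insert w V)" using fin by simp
    show "Suc (max_degree V E) \<in> degree ?E ` insert w V" using dx x(1) by force
    show "k \<le> Suc (max_degree V E)" if "k \<in> degree ?E ` insert w V" for k
      using that dy dw by auto
  qed
qed

text \<open>Each leaf hung on a vertex of maximum degree raises the maximum by one and leaves the
  paths, hence all intersections, unchanged.\<close>

lemma helly_h22_of_max_degree_le:
  fixes VT :: "nat set"
  assumes "helly_ept_rep V E VT ET P" "max_degree VT ET \<le> h"
  shows "helly_h22 V E h"
  using assms
proof (induction "h - max_degree VT ET" arbitrary: VT ET)
  case 0
  then have "max_degree VT ET = h" by simp
  then show ?case using 0 unfolding helly_h22_def by blast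
next
  case (Suc n)
  have tr: "is_tree VT ET" using Suc.prems by (simp add: helly_ept_rep_def ept_rep_def)
  then have g: "graph VT ET" and fin: "finite VT" and ne: "VT \<noteq> {}" by (auto simp: is_tree_def graph_def)
  then have "max_degree VT ET \<in> degree ET ` VT" unfolding max_degree_def by (intro Max_in) auto
  then obtain x where x: "x \<in> VT" "degree ET x = max_degree VT ET" by auto
  obtain w where w: "w \<notin> VT" using fin ex_new_if_finite[OF infinite_UNIV_nat] by blast
  have "helly_ept_rep V E (insert w VT) (insert {w, x} ET) P"
    using Suc.prems(1) is_tree_add_leaf[OF tr x(1) w] tree_subpath_mono[of VT ET _ "insert w VT" "insert {w, x} ET"]
    unfolding helly_ept_rep_def ept_rep_def by (simp add: subset_insertI)
  then show ?case
    using Suc.hyps(1)[of "insert w VT" "insert {w, x} ET"] max_degree_add_leaf[OF g x w] Suc.hyps(2) by simp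
qed

text \<open>In a representation of least excess, a vertex of degree above \<open>h\<close>, hence at
  least 4, would yield either a gate with that many cliques or a representation of smaller
  excess.\<close>

lemma helly_h22_of_no_gate:
  assumes g: "graph V E" and ept: "helly_ept V E" and h: "h \<ge> 3"
    and no: "\<And>k. k > h \<Longrightarrow> \<not> has_induced_k_gate V E k"
  shows "helly_h22 V E h"
proof -
  let ?Q = "\<lambda>n. \<exists>(VT :: nat set) ET P. helly_ept_rep V E VT ET P \<and> excess VT ET = n"
  have "\<exists>n. ?Q n" using ept unfolding helly_ept_def by blast
  then obtain n where n: "?Q n" "\<And>m. m < n \<Longrightarrow> \<not> ?Q m" using exists_least_iff[of ?Q] by blast
  then obtain VT :: "nat set" and ET P where rep: "helly_ept_rep V E VT ET P" and ex: "excess VT ET = n"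
    by blast
  have deg: "degree ET q \<le> h" if q: "q \<in> VT" for q
  proof (rule ccontr)
    assume "\<not> ?thesis"
    then have d: "degree ET q \<ge> 4" "degree ET q > h" using h by auto
    then show False using split_or_gate[OF g rep q d(1)] no[OF d(2)] n(2) ex by blast
  qed
  have "finite VT" "VT \<noteq> {}" using rep by (auto simp: helly_ept_rep_def ept_rep_def is_tree_def graph_def)
  then have "max_degree VT ET \<le> h" unfolding max_degree_def using deg by simp
  then show ?thesis using helly_h22_of_max_degree_le[OF rep] by simp
qed

theorem theorem9:
  fixes V :: "'a set" and E :: "'a set set" and h :: nat
  assumes "graph V E"
    and "helly_ept V E"
    and "h \<ge> 3"
  shows "\<not> helly_h22 V E h \<longleftrightarrow> (\<exists>k > h. has_induced_k_gate V E k)"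
  using helly_h22_of_no_gate[OF assms] k_gate_imp_not_helly_h22 by blast

end
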